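(* Let $0<q<1$ and $a>0$. For all integers $n,n'\ge 0$ the polynomials $\tilde D_n^{(a)}(\,\cdot\,|q)$ satisfy both of the following orthogonality relations, where $\mu(x):=q^{-x}-aq^{x+1}$: $$\sum_{k=0}^\infty \frac{(1+aq^{4k+1})(-aq;q)_{2k}}{(1+aq)(q;q)_{2k}}\, q^{k(2k-1)}\, \tilde D_n^{(a)}(\mu (2k)|q)\,\tilde D_{n'}^{(a)}(\mu (2k)|q) =\frac{(-aq^3;q^2)_\infty}{(q;q^2)_\infty}\, \frac{(q^2;q^2)_n\,q^{-n}}{(-aq^2;q^2)_n}\, \delta_{nn'} ,$$ $$\sum_{k=0}^\infty \frac{(1+aq^{4k+3})(-aq;q)_{2k+1}}{(1+aq)(q;q)_{2k+1}}\, q^{k(2k+1)}\, \tilde D_n^{(a)}(\mu (2k+1)|q)\,\tilde D_{n'}^{(a)}(\mu (2k+1)|q) =\frac{(-aq^3;q^2)_\infty}{(q;q^2)_\infty}\, \frac{(q^2;q^2)_n\,q^{-n}}{(-aq^2;q^2)_n}\,\delta_{nn'} .$$ Moreover, both corresponding orthogonality measures (the first supported on the points $\mu(2k)$, the second on the points $\mu(2k+1)$, $k=0,1,2,\dots$) are extremal.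
   Context: Notation: $(b;q)_m=\prod_{j=0}^{m-1}(1-bq^j)$, $(b;q)_\infty=\prod_{j\ge 0}(1-bq^j)$, $(b_1,\dots,b_r;q)_m=\prod_i (b_i;q)_m$. For $a>0$ the polynomials $\tilde D_n^{(a)}(y|q)$ (dual discrete $q$-ultraspherical polynomials with imaginary parameter) are defined by $$\tilde D_n^{(a)}(\mu(x)|q):={}_3\phi_2\left(q^{-x},\,-aq^{x+1},\,q^{-n};\ \mathrm i\sqrt a\,q,\,-\mathrm i\sqrt a\,q;\ q,\,-q^{n+1}\right)=\sum_{m=0}^n\frac{(q^{-x},-aq^{x+1},q^{-n};q)_m}{(\mathrm i\sqrt a\,q,-\mathrm i\sqrt a\,q,q;q)_m}(-q^{n+1})^m,\qquad \mu(x)=q^{-x}-aq^{x+1}.$$ Since $(q^{-x},-aq^{x+1};q)_m=\prod_{j=0}^{m-1}\bigl(1-aq^{2j+1}-q^j\mu(x)\bigr)$ and $(\mathrm i\sqrt a\,q,-\mathrm i\sqrt a\,q;q)_m=(-aq^2;q^2)_m$, $\tilde D_n^{(a)}(y|q)$ is a real polynomial of degree $n$ in $y=\mu(x)$. A positive orthogonality measure $\sigma$ on $\mathbb R$ for a family of polynomials is called extremal if the polynomials form a complete orthogonal set in the Hilbert space $L^2(\sigma)$ (i.e. their linear span is dense in $L^2(\sigma)$). *)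

theory Defs
  imports "HOL-Analysis.Analysis" "HOL-Computational_Algebra.Polynomial"
begin

definition qpoch :: "'a::comm_ring_1 \<Rightarrow> 'a \<Rightarrow> nat \<Rightarrow> 'a" where
  "qpoch b q m = (\<Prod>j<m. 1 - b * q ^ j)"

definition qpoch_inf :: "real \<Rightarrow> real \<Rightarrow> real" where
  "qpoch_inf b q = (\<Prod>j. 1 - b * q ^ j)"

definition phi32 ::
    "complex \<Rightarrow> complex \<Rightarrow> complex \<Rightarrow> complex \<Rightarrow> complex \<Rightarrow> complex \<Rightarrow> complex \<Rightarrow> complex" where
  "phi32 a1 a2 a3 b1 b2 q z =
     (\<Sum>m. (qpoch a1 q m * qpoch a2 q m * qpoch a3 q m)
           / (qpoch b1 q m * qpoch b2 q m * qpoch q q m) * z ^ m)"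

definition mu :: "real \<Rightarrow> real \<Rightarrow> real \<Rightarrow> real" where
  "mu a q x = q powr (- x) - a * q powr (x + 1)"

text \<open>
  The polynomial is specified through its values at the points \<open>mu a q x\<close>.
  For \<open>0 < q < 1\<close> and \<open>a > 0\<close> it exists and is unique: see \<open>phi32_eq_dualD_expl\<close> and
  \<open>dualD_eq_expl\<close> below.
\<close>

definition dualD :: "real \<Rightarrow> real \<Rightarrow> nat \<Rightarrow> real poly" where
  "dualD a q n = (THE p. \<forall>x::real. complex_of_real (poly p (mu a q x)) =
     phi32 (of_real (q powr (- x))) (of_real (- a * q powr (x + 1))) (of_real (q powi (- int n)))
       (\<i> * of_real (sqrt a * q)) (- \<i> * of_real (sqrt a * q))
       (of_real q) (of_real (- (q ^ (n + 1)))))"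

definition dualD_expl :: "real \<Rightarrow> real \<Rightarrow> nat \<Rightarrow> real poly" where
  "dualD_expl a q n = (\<Sum>m\<le>n. smult
     (qpoch (q powi (- int n)) q m / (qpoch (- a * q\<^sup>2) (q\<^sup>2) m * qpoch q q m) * (- (q ^ (n + 1))) ^ m)
     (\<Prod>j<m. [:1 - a * q ^ (2 * j + 1), - (q ^ j):]))"

lemma qpoch_of_real: "qpoch (of_real b) (of_real q) m = (of_real (qpoch b q m) :: complex)"
  by (simp add: qpoch_def)

lemma qpoch_mu:
  assumes "0 < q"
  shows "qpoch (q powr (- x)) q m * qpoch (- a * q powr (x + 1)) q m =
         (\<Prod>j<m. 1 - a * q ^ (2 * j + 1) - q ^ j * mu a q x)"
proof -
  have e: "q powr (- x) * q powr (x + 1) = q"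
    using assms by (simp flip: powr_add)
  have "(1 - q powr (- x) * q ^ j) * (1 - (- a * q powr (x + 1)) * q ^ j) =
        1 - a * q ^ (2 * j + 1) - q ^ j * mu a q x" for j
  proof -
    have "(1 - q powr (- x) * q ^ j) * (1 - (- a * q powr (x + 1)) * q ^ j) =
        1 - a * (q powr (- x) * q powr (x + 1)) * (q ^ j * q ^ j) - q ^ j * mu a q x"
      by (simp add: mu_def algebra_simps)
    also have "a * (q powr (- x) * q powr (x + 1)) * (q ^ j * q ^ j) = a * q ^ (2 * j + 1)"
      unfolding e by (simp add: power_add power_even_eq power2_eq_square)
    finally show ?thesis .
  qed
  then show ?thesis
    by (simp add: qpoch_def flip: prod.distrib)
qed

lemma qpoch_imag:
  assumes "0 < a"
  shows "qpoch (\<i> * of_real (sqrt a * q)) (of_real q) m * qpoch (- \<i> * of_real (sqrt a * q)) (of_real q) m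
         = (of_real (qpoch (- a * q\<^sup>2) (q\<^sup>2) m) :: complex)"
proof -
  have s: "complex_of_real (sqrt a) * complex_of_real (sqrt a) = of_real a"
    using assms by (simp flip: of_real_mult)
  have "(1 - \<i> * of_real (sqrt a * q) * of_real q ^ j) * (1 - (- \<i> * of_real (sqrt a * q)) * of_real q ^ j)
        = (1 - (- of_real a * (of_real q)\<^sup>2) * ((of_real q)\<^sup>2) ^ j :: complex)" for j
  proof -
    have "(1 - \<i> * of_real (sqrt a * q) * of_real q ^ j) * (1 - (- \<i> * of_real (sqrt a * q)) * of_real q ^ j)
        = (1 + (complex_of_real (sqrt a) * complex_of_real (sqrt a)) * (of_real q * of_real q) * (of_real q ^ j * of_real q ^ j) :: complex)"
      by (simp add: algebra_simps)
    then show ?thesis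
      unfolding s by (simp only: power2_eq_square power_mult_distrib mult_ac mult_minus_left mult_minus_right diff_minus_eq_add)
  qed
  then show ?thesis
    by (simp add: qpoch_def flip: prod.distrib)
qed

lemma qpoch_terminates:
  assumes "0 < (q::real)" "n < m"
  shows "qpoch (q powi (- int n)) q m = 0"
proof -
  have "1 - q powi (- int n) * q ^ n = 0"
    using assms by (simp add: power_int_minus)
  then show ?thesis
    using assms(2) unfolding qpoch_def by (intro prod_zero) auto
qed

lemma phi32_eq_dualD_expl:
  assumes "0 < q" "0 < a"
  shows "complex_of_real (poly (dualD_expl a q n) (mu a q x)) =
     phi32 (of_real (q powr (- x))) (of_real (- a * q powr (x + 1))) (of_real (q powi (- int n)))
       (\<i> * of_real (sqrt a * q)) (- \<i> * of_real (sqrt a * q))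
       (of_real q) (of_real (- (q ^ (n + 1))))"
proof -
  define T where "T m = qpoch (q powi (- int n)) q m / (qpoch (- a * q\<^sup>2) (q\<^sup>2) m * qpoch q q m)
     * (- (q ^ (n + 1))) ^ m * (\<Prod>j<m. 1 - a * q ^ (2 * j + 1) - q ^ j * mu a q x)" for m
  have tm: "qpoch (of_real (q powr (- x))) (of_real q) m * qpoch (of_real (- a * q powr (x + 1))) (of_real q) m
        * qpoch (of_real (q powi (- int n))) (of_real q) m
        / (qpoch (\<i> * of_real (sqrt a * q)) (of_real q) m * qpoch (- \<i> * of_real (sqrt a * q)) (of_real q) m
           * qpoch (of_real q) (of_real q) m) * of_real (- (q ^ (n + 1))) ^ m = complex_of_real (T m)" for m
    unfolding qpoch_imag[OF assms(2)] qpoch_of_real T_def qpoch_mu[OF assms(1), symmetric]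
    by (simp add: field_simps)
  have "phi32 (of_real (q powr (- x))) (of_real (- a * q powr (x + 1))) (of_real (q powi (- int n)))
       (\<i> * of_real (sqrt a * q)) (- \<i> * of_real (sqrt a * q))
       (of_real q) (of_real (- (q ^ (n + 1)))) = (\<Sum>m. complex_of_real (T m))"
    unfolding phi32_def tm ..
  also have "\<dots> = (\<Sum>m\<le>n. complex_of_real (T m))"
    by (rule suminf_finite) (auto simp: T_def qpoch_terminates[OF assms(1)])
  also have "\<dots> = complex_of_real (poly (dualD_expl a q n) (mu a q x))"
    by (simp add: dualD_expl_def T_def poly_sum poly_prod mult_ac)
  finally show ?thesis ..
qed

lemma mu_strict_mono:
  assumes "0 < q" "q < 1" "0 < a"
  shows "strict_mono (mu a q)"
proof (rule strict_monoI)
  fix x y :: real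
  assume "x < y"
  then have "q powr (- x) < q powr (- y)" "q powr (y + 1) < q powr (x + 1)"
    using assms by (auto intro: powr_less_mono')
  then show "mu a q x < mu a q y"
    using assms by (auto simp: mu_def intro!: diff_strict_mono)
qed

lemma dualD_eq_expl:
  assumes "0 < q" "q < 1" "0 < a"
  shows "dualD a q n = dualD_expl a q n"
  unfolding dualD_def
proof (rule the_equality)
  show "\<forall>x. complex_of_real (poly (dualD_expl a q n) (mu a q x)) =
     phi32 (of_real (q powr (- x))) (of_real (- a * q powr (x + 1))) (of_real (q powi (- int n)))
       (\<i> * of_real (sqrt a * q)) (- \<i> * of_real (sqrt a * q))
       (of_real q) (of_real (- (q ^ (n + 1))))"
    using phi32_eq_dualD_expl assms by blast
next
  fix p
  assume "\<forall>x. complex_of_real (poly p (mu a q x)) =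
     phi32 (of_real (q powr (- x))) (of_real (- a * q powr (x + 1))) (of_real (q powi (- int n)))
       (\<i> * of_real (sqrt a * q)) (- \<i> * of_real (sqrt a * q))
       (of_real q) (of_real (- (q ^ (n + 1))))"
  then have eq: "poly (p - dualD_expl a q n) (mu a q x) = 0" for x
    using phi32_eq_dualD_expl[OF assms(1,3), of n x]
    by (metis diff_self of_real_eq_iff poly_diff)
  have "infinite (range (mu a q))"
    using mu_strict_mono[OF assms] strict_mono_imp_inj_on infinite_UNIV_char_0 finite_imageD by blast
  moreover have "range (mu a q) \<subseteq> {y. poly (p - dualD_expl a q n) y = 0}"
    using eq by auto
  ultimately have "p - dualD_expl a q n = 0"
    using poly_roots_finite finite_subset by blast
  then show "p = dualD_expl a q n" by simp
qed

text \<open>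
  Measures on the Borel sets of the real line are positive by construction.  Completeness means
  density of the linear span in the real Hilbert space of square-integrable functions.
\<close>

definition orthogonality_measure :: "real measure \<Rightarrow> (nat \<Rightarrow> real poly) \<Rightarrow> bool" where
  "orthogonality_measure \<sigma> p \<longleftrightarrow>
     sets \<sigma> = sets borel \<and>
     (\<forall>m n. integrable \<sigma> (\<lambda>y. poly (p m) y * poly (p n) y)) \<and>
     (\<forall>m n. m \<noteq> n \<longrightarrow> (LINT y|\<sigma>. poly (p m) y * poly (p n) y) = 0) \<and>
     (\<forall>n. (LINT y|\<sigma>. (poly (p n) y)\<^sup>2) > 0)"

definition extremal :: "real measure \<Rightarrow> (nat \<Rightarrow> real poly) \<Rightarrow> bool" where
  "extremal \<sigma> p \<longleftrightarrow>
     orthogonality_measure \<sigma> p \<and>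
     (\<forall>f \<in> borel_measurable \<sigma>. integrable \<sigma> (\<lambda>y. (f y)\<^sup>2) \<longrightarrow>
        (\<forall>\<epsilon>>0. \<exists>N c. (\<integral>\<^sup>+y. ennreal ((f y - (\<Sum>n<N. c n * poly (p n) y))\<^sup>2) \<partial>\<sigma>) < ennreal \<epsilon>))"

text \<open>For \<open>k = 0\<close> the truncated subtraction is harmless: the exponent is \<open>0\<close> either way.\<close>

definition weight_even :: "real \<Rightarrow> real \<Rightarrow> nat \<Rightarrow> real" where
  "weight_even a q k =
     (1 + a * q ^ (4 * k + 1)) * qpoch (- a * q) q (2 * k)
     / ((1 + a * q) * qpoch q q (2 * k)) * q ^ (k * (2 * k - 1))"

definition weight_odd :: "real \<Rightarrow> real \<Rightarrow> nat \<Rightarrow> real" where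
  "weight_odd a q k =
     (1 + a * q ^ (4 * k + 3)) * qpoch (- a * q) q (2 * k + 1)
     / ((1 + a * q) * qpoch q q (2 * k + 1)) * q ^ (k * (2 * k + 1))"

definition discrete_measure :: "(nat \<Rightarrow> real) \<Rightarrow> (nat \<Rightarrow> real) \<Rightarrow> real measure" where
  "discrete_measure w y = distr (density (count_space UNIV) (\<lambda>k. ennreal (w k))) borel y"

text \<open>\<open>discrete_measure w y\<close> has mass \<open>w k\<close> at the point \<open>y k\<close>.  As \<open>ennreal\<close> sends negative
  numbers to \<open>0\<close>, this requires nonnegative weights, which is the case here:\<close>

lemma weight_nonneg:
  assumes "0 < q" "q < 1" "0 < a"
  shows "weight_even a q k \<ge> 0" "weight_odd a q k \<ge> 0"
proof -
  have "0 \<le> qpoch (- a * q) q m" "0 \<le> qpoch q q m" for m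
  proof -
    have "q * q ^ j \<le> 1" for j
      using assms by (simp add: power_le_one flip: power_Suc)
    then show "0 \<le> qpoch (- a * q) q m" "0 \<le> qpoch q q m"
      using assms by (auto simp: qpoch_def intro!: prod_nonneg add_nonneg_nonneg)
  qed
  then show "weight_even a q k \<ge> 0" "weight_odd a q k \<ge> 0"
    using assms by (auto simp: weight_even_def weight_odd_def intro!: mult_nonneg_nonneg divide_nonneg_nonneg)
qed

end

theory Submission
  imports Defs
begin

text \<open>
  Put \<open>x = q^n\<close>.  As a function of \<open>x\<close>, the value of the \<open>n\<close>-th polynomial at \<open>\<mu>(m)\<close> is a polynomial
  \<open>R_m(x)\<close> of degree \<open>m\<close> and of the parity of \<open>m\<close>, satisfying a three-term recurrence in \<open>m\<close>.  For the
  masses \<open>v_n = q^n (-aq^2;q^2)_n / (q^2;q^2)_n\<close> at the points \<open>q^n\<close>, the moments of \<open>x^l R_m(x)\<close> with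
  \<open>l + m\<close> even have a closed product form, so that the \<open>R_m\<close> with \<open>m\<close> of a fixed parity are orthogonal;
  their squared norms are, up to a constant, the reciprocals of the weights in the theorem.  They are also complete, because
  Lagrange interpolation at \<open>1, q, \<dots>, q^(N-1)\<close> by polynomials of the given parity stays bounded at the
  remaining points, whose total mass tends to \<open>0\<close>.  The normalised matrix \<open>R_{2k+p}(q^n)\<close> is therefore
  unitary, and the unitarity of its transpose is the orthogonality of the dual polynomials together
  with their completeness.
\<close>

section \<open>Unitary infinite matrices\<close>

text \<open>Expand the square: since \<open>f\<close> has finite support, its inner products with
  the rows are finite sums, and orthonormality leaves only the diagonal of the double sum.
  Completing the square in \<open>c\<close> isolates the excess over the Fourier coefficients of
  \<open>f\<close>, so one formula gives both Bessel's inequality and the comparison of an arbitrary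
  approximation with the best one.\<close>

lemma orthonormal_residual_sums:
  fixes V :: "nat \<Rightarrow> nat \<Rightarrow> real" and f c :: "nat \<Rightarrow> real"
  assumes orth: "\<And>i i'. (\<lambda>j. V i j * V i' j) sums (if i = i' then 1 else 0)"
    and supp: "\<And>j. j \<ge> J \<Longrightarrow> f j = 0"
  shows "(\<lambda>j. (f j - (\<Sum>i<I. c i * V i j))\<^sup>2) sums
    ((\<Sum>j<J. (f j)\<^sup>2) - (\<Sum>i<I. (\<Sum>j<J. f j * V i j)\<^sup>2)
      + (\<Sum>i<I. (c i - (\<Sum>j<J. f j * V i j))\<^sup>2))"
proof -
  define g where "g i = (\<Sum>j<J. f j * V i j)" for i
  have 1: "(\<lambda>j. (f j)\<^sup>2) sums (\<Sum>j<J. (f j)\<^sup>2)"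
    by (rule sums_finite) (auto simp: supp)
  have 2: "(\<lambda>j. f j * V i j) sums g i" for i
    unfolding g_def by (rule sums_finite) (auto simp: supp)
  have 3: "(\<lambda>j. \<Sum>i<I. 2 * c i * (f j * V i j)) sums (\<Sum>i<I. 2 * c i * g i)"
    by (intro sums_sum sums_mult 2)
  have 4: "(\<lambda>j. \<Sum>i<I. \<Sum>i'<I. c i * c i' * (V i j * V i' j)) sums
      (\<Sum>i<I. \<Sum>i'<I. c i * c i' * (if i = i' then 1 else 0))"
    by (intro sums_sum sums_mult orth)
  have 5: "(\<Sum>i<I. \<Sum>i'<I. c i * c i' * (if i = i' then 1 else 0)) = (\<Sum>i<I. (c i)\<^sup>2)"
    by (intro sum.cong refl) (simp add: if_distrib[of "(*) _"] power2_eq_square cong: if_cong)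
  have 6: "(f j - (\<Sum>i<I. c i * V i j))\<^sup>2 = (f j)\<^sup>2 - (\<Sum>i<I. 2 * c i * (f j * V i j))
      + (\<Sum>i<I. \<Sum>i'<I. c i * c i' * (V i j * V i' j))" for j
    by (simp add: power2_diff power2_eq_square[of "sum _ _"] sum_product sum_distrib_left mult_ac)
  have "(\<lambda>j. (f j - (\<Sum>i<I. c i * V i j))\<^sup>2) sums
    ((\<Sum>j<J. (f j)\<^sup>2) - (\<Sum>i<I. 2 * c i * g i) + (\<Sum>i<I. (c i)\<^sup>2))"
    unfolding 6 by (intro sums_add sums_diff 1 3 4[unfolded 5])
  also have "(\<Sum>j<J. (f j)\<^sup>2) - (\<Sum>i<I. 2 * c i * g i) + (\<Sum>i<I. (c i)\<^sup>2)
      = (\<Sum>j<J. (f j)\<^sup>2) - (\<Sum>i<I. (g i)\<^sup>2) + (\<Sum>i<I. (c i - g i)\<^sup>2)"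
    by (simp add: power2_diff sum.distrib sum_subtractf algebra_simps)
  finally show ?thesis unfolding g_def .
qed

lemma orthonormal_unit_residual_sums:
  fixes V :: "nat \<Rightarrow> nat \<Rightarrow> real" and c :: "nat \<Rightarrow> real"
  assumes orth: "\<And>i i'. (\<lambda>j. V i j * V i' j) sums (if i = i' then 1 else 0)"
  shows "(\<lambda>j. ((if j = n then 1 else 0) - (\<Sum>i<I. c i * V i j))\<^sup>2) sums
    (1 - (\<Sum>i<I. (V i n)\<^sup>2) + (\<Sum>i<I. (c i - V i n)\<^sup>2))"
proof -
  have *: "(\<Sum>j<Suc n. (if j = n then 1 else 0) * g j) = g n" for g :: "nat \<Rightarrow> real"
    by (subst sum.lessThan_Suc) simp
  have **: "(\<Sum>j<Suc n. (if j = n then 1 else 0 :: real)\<^sup>2) = 1"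
    by (subst sum.lessThan_Suc) simp
  show ?thesis
    using orthonormal_residual_sums[OF orth, where J = "Suc n" and f = "\<lambda>j. if j = n then 1 else 0" and I = I and c = c]
    unfolding * ** by simp
qed

text \<open>Parseval for a unit vector, whose Fourier coefficients form column \<open>n\<close>.
  Bessel bounds the partial sums by 1; conversely the error of any approximation bounds the Bessel
  defect, and the partial sums increase.\<close>

lemma orthonormal_complete_imp_coordinate_sums:
  fixes V :: "nat \<Rightarrow> nat \<Rightarrow> real"
  assumes orth: "\<And>i i'. (\<lambda>j. V i j * V i' j) sums (if i = i' then 1 else 0)"
    and approx: "\<And>\<epsilon>. \<epsilon> > 0 \<Longrightarrow> \<exists>I c s. (\<lambda>j. ((if j = n then 1 else 0) - (\<Sum>i<I. c i * V i j))\<^sup>2) sums s \<and> s < \<epsilon>"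
  shows "(\<lambda>i. (V i n)\<^sup>2) sums 1"
proof -
  have bessel: "(\<Sum>i<I. (V i n)\<^sup>2) \<le> 1" for I
  proof -
    have "0 \<le> 1 - (\<Sum>i<I. (V i n)\<^sup>2) + (\<Sum>i<I. (V i n - V i n)\<^sup>2)"
      by (rule sums_le[OF _ sums_zero orthonormal_unit_residual_sums[OF orth, where c = "\<lambda>i. V i n" and n = n]]) simp
    then show ?thesis by simp
  qed
  show ?thesis
    unfolding sums_def
  proof (rule order_tendstoI)
    fix y :: real assume "1 < y"
    then show "\<forall>\<^sub>F I in sequentially. (\<Sum>i<I. (V i n)\<^sup>2) < y"
      using bessel by (intro always_eventually allI) (rule le_less_trans)
  next
    fix y :: real assume y: "y < 1"
    then obtain I c s where s: "(\<lambda>j. ((if j = n then 1 else 0) - (\<Sum>i<I. c i * V i j))\<^sup>2) sums s"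
      "s < 1 - y" using approx[of "1 - y"] by auto
    have "s = 1 - (\<Sum>i<I. (V i n)\<^sup>2) + (\<Sum>i<I. (c i - V i n)\<^sup>2)"
      by (rule sums_unique2[OF s(1) orthonormal_unit_residual_sums[OF orth]])
    moreover have "0 \<le> (\<Sum>i<I. (c i - V i n)\<^sup>2)" by (intro sum_nonneg) simp
    ultimately have "y < (\<Sum>i<I. (V i n)\<^sup>2)" using s(2) by linarith
    also have "\<dots> \<le> (\<Sum>i<I'. (V i n)\<^sup>2)" if "I \<le> I'" for I'
      using that by (intro sum_mono2) auto
    finally show "\<forall>\<^sub>F I in sequentially. y < (\<Sum>i<I. (V i n)\<^sup>2)"
      by (auto simp: eventually_sequentially)
  qed
qed

text \<open>Expand the \<open>n\<close>-th unit vector in the rows. The squared norm of the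
  remainder after \<open>I\<close> terms is one minus a partial sum of \<open>coord\<close>, hence
  tends to 0; it dominates the square of the remainder's \<open>m\<close>-th coordinate, which is
  the defect of the claimed column relation.\<close>

lemma orthonormal_transpose:
  fixes V :: "nat \<Rightarrow> nat \<Rightarrow> real"
  assumes orth: "\<And>i i'. (\<lambda>j. V i j * V i' j) sums (if i = i' then 1 else 0)"
    and coord: "\<And>n. (\<lambda>i. (V i n)\<^sup>2) sums 1"
  shows "(\<lambda>i. V i m * V i n) sums (if m = n then 1 else 0)"
proof -
  let ?d = "if m = n then 1 else 0 :: real"
  have le: "(?d - (\<Sum>i<I. V i n * V i m))\<^sup>2 \<le> 1 - (\<Sum>i<I. (V i n)\<^sup>2)" for I
  proof -
    have S: "(\<lambda>j. ((if j = n then 1 else 0) - (\<Sum>i<I. V i n * V i j))\<^sup>2) sums (1 - (\<Sum>i<I. (V i n)\<^sup>2))"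
      using orthonormal_unit_residual_sums[OF orth, where c = "\<lambda>i. V i n" and n = n and I = I] by simp
    show ?thesis
      using sum_le_suminf[OF sums_summable[OF S], of "{m}"] sums_unique[OF S] by simp
  qed
  have lim: "(\<lambda>I. 1 - (\<Sum>i<I. (V i n)\<^sup>2)) \<longlonglongrightarrow> 1 - 1"
    using coord[of n] unfolding sums_def by (intro tendsto_diff tendsto_const)
  have "(\<lambda>I. (?d - (\<Sum>i<I. V i n * V i m))\<^sup>2) \<longlonglongrightarrow> 0"
  proof (rule tendsto_sandwich[OF always_eventually always_eventually tendsto_const])
    show "\<forall>I. (?d - (\<Sum>i<I. V i n * V i m))\<^sup>2 \<le> 1 - (\<Sum>i<I. (V i n)\<^sup>2)"
      using le by blast
    show "(\<lambda>I. 1 - (\<Sum>i<I. (V i n)\<^sup>2)) \<longlonglongrightarrow> 0"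
      using lim by simp
  qed (rule allI, rule zero_le_power2)
  from tendsto_real_sqrt[OF this] have "(\<lambda>I. ?d - (\<Sum>i<I. V i n * V i m)) \<longlonglongrightarrow> 0"
    unfolding real_sqrt_abs real_sqrt_zero by (rule tendsto_rabs_zero_cancel)
  then have "(\<lambda>I. ?d - (?d - (\<Sum>i<I. V i n * V i m))) \<longlonglongrightarrow> ?d - 0"
    by (intro tendsto_diff tendsto_const)
  then show ?thesis
    by (simp add: sums_def mult.commute)
qed

text \<open>Split \<open>f\<close> into a truncation \<open>f1\<close> and a tail \<open>f2\<close>
  of small norm. Column orthonormality yields Parseval for the finitely supported \<open>f1\<close>,
  so its Fourier expansion in the rows converges in norm.\<close>

lemma orthonormal_transpose_dense:
  fixes V :: "nat \<Rightarrow> nat \<Rightarrow> real" and f :: "nat \<Rightarrow> real" and \<epsilon> :: real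
  assumes orth: "\<And>i i'. (\<lambda>j. V i j * V i' j) sums (if i = i' then 1 else 0)"
    and orthT: "\<And>j j'. (\<lambda>i. V i j * V i j') sums (if j = j' then 1 else 0)"
    and f: "summable (\<lambda>j. (f j)\<^sup>2)" and eps: "\<epsilon> > 0"
  shows "\<exists>I c s. (\<lambda>j. (f j - (\<Sum>i<I. c i * V i j))\<^sup>2) sums s \<and> s < \<epsilon>"
proof -
  have "\<forall>\<^sub>F J in sequentially. dist (\<Sum>j<J. (f j)\<^sup>2) (\<Sum>j. (f j)\<^sup>2) < \<epsilon> / 4"
    using summable_LIMSEQ[OF f] eps by (intro tendstoD) auto
  then obtain J where J: "dist (\<Sum>j<J. (f j)\<^sup>2) (\<Sum>j. (f j)\<^sup>2) < \<epsilon> / 4"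
    by (auto simp: eventually_sequentially)
  define f1 where "f1 j = (if j < J then f j else 0)" for j
  define f2 where "f2 j = (if j < J then 0 else f j)" for j
  have f2s: "(\<lambda>j. (f2 j)\<^sup>2) sums ((\<Sum>j. (f j)\<^sup>2) - (\<Sum>j<J. (f j)\<^sup>2))"
  proof -
    have "(\<lambda>j. (f1 j)\<^sup>2) sums (\<Sum>j<J. (f1 j)\<^sup>2)"
      by (rule sums_finite) (auto simp: f1_def)
    then have "(\<lambda>j. (f j)\<^sup>2 - (f1 j)\<^sup>2) sums ((\<Sum>j. (f j)\<^sup>2) - (\<Sum>j<J. (f1 j)\<^sup>2))"
      by (intro sums_diff summable_sums f)
    moreover have "(f j)\<^sup>2 - (f1 j)\<^sup>2 = (f2 j)\<^sup>2" for j by (simp add: f1_def f2_def)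
    moreover have "(\<Sum>j<J. (f1 j)\<^sup>2) = (\<Sum>j<J. (f j)\<^sup>2)" by (simp add: f1_def)
    ultimately show ?thesis by simp
  qed
  define g where "g i = (\<Sum>j<J. f1 j * V i j)" for i
  have "(\<lambda>i. (g i)\<^sup>2) sums (\<Sum>j<J. (f1 j)\<^sup>2)"
  proof -
    have "(\<lambda>i. \<Sum>j<J. \<Sum>j'<J. f1 j * f1 j' * (V i j * V i j')) sums
        (\<Sum>j<J. \<Sum>j'<J. f1 j * f1 j' * (if j = j' then 1 else 0))"
      by (intro sums_sum sums_mult orthT)
    moreover have "(\<Sum>j<J. \<Sum>j'<J. f1 j * f1 j' * (if j = j' then 1 else 0)) = (\<Sum>j<J. (f1 j)\<^sup>2)"
      by (intro sum.cong refl) (simp add: if_distrib[of "(*) _"] power2_eq_square cong: if_cong)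
    moreover have "(\<Sum>j<J. \<Sum>j'<J. f1 j * f1 j' * (V i j * V i j')) = (g i)\<^sup>2" for i
      by (simp add: g_def power2_eq_square sum_product mult_ac)
    ultimately show ?thesis by simp
  qed
  then have "\<forall>\<^sub>F I in sequentially. dist (\<Sum>i<I. (g i)\<^sup>2) (\<Sum>j<J. (f1 j)\<^sup>2) < \<epsilon> / 4"
    using eps unfolding sums_def by (intro tendstoD) auto
  then obtain I where I: "dist (\<Sum>i<I. (g i)\<^sup>2) (\<Sum>j<J. (f1 j)\<^sup>2) < \<epsilon> / 4"
    by (auto simp: eventually_sequentially)
  have f1s: "(\<lambda>j. (f1 j - (\<Sum>i<I. g i * V i j))\<^sup>2) sums ((\<Sum>j<J. (f1 j)\<^sup>2) - (\<Sum>i<I. (g i)\<^sup>2))"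
    using orthonormal_residual_sums[OF orth, where J = J and f = f1 and I = I and c = g] by (simp add: f1_def g_def)
  \<comment> \<open>The bound \<open>(u + v)^2 <= 2 * u^2 + 2 * v^2\<close> doubles each of the two
    errors, which is why both were taken below a quarter of \<open>\<epsilon>\<close>.\<close>
  define s where "s = 2 * ((\<Sum>j<J. (f1 j)\<^sup>2) - (\<Sum>i<I. (g i)\<^sup>2))
      + 2 * ((\<Sum>j. (f j)\<^sup>2) - (\<Sum>j<J. (f j)\<^sup>2))"
  have B: "(\<lambda>j. 2 * (f1 j - (\<Sum>i<I. g i * V i j))\<^sup>2 + 2 * (f2 j)\<^sup>2) sums s"
    unfolding s_def by (intro sums_add sums_mult f1s f2s)
  have le: "(f j - (\<Sum>i<I. g i * V i j))\<^sup>2 \<le> 2 * (f1 j - (\<Sum>i<I. g i * V i j))\<^sup>2 + 2 * (f2 j)\<^sup>2" for j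
  proof -
    have "f j - (\<Sum>i<I. g i * V i j) = (f1 j - (\<Sum>i<I. g i * V i j)) + f2 j"
      by (simp add: f1_def f2_def)
    moreover have "(u + v)\<^sup>2 \<le> 2 * u\<^sup>2 + 2 * v\<^sup>2" for u v :: real
      using sum_squares_bound[of u v] by (simp add: power2_sum)
    ultimately show ?thesis by (simp only:)
  qed
  have S: "summable (\<lambda>j. (f j - (\<Sum>i<I. g i * V i j))\<^sup>2)"
    by (rule summable_comparison_test'[OF sums_summable[OF B], of 0]) (use le in auto)
  have "(\<Sum>j. (f j - (\<Sum>i<I. g i * V i j))\<^sup>2) \<le> s"
    by (rule sums_le[OF le summable_sums[OF S] B])
  also have "s < \<epsilon>"
  proof -
    have "2 * (y - x) + 2 * (v - u) < \<epsilon>" if "\<bar>x - y\<bar> < \<epsilon> / 4" "\<bar>u - v\<bar> < \<epsilon> / 4" for x y u v :: real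
    proof -
      have "(y - x) + (v - u) < \<epsilon> / 2" using that by linarith
      then show ?thesis by (simp add: field_simps)
    qed
    then show ?thesis using I J unfolding s_def dist_real_def by blast
  qed
  finally show ?thesis
    using summable_sums[OF S] by blast
qed

section \<open>Discrete measures\<close>

lemma discrete_measure_space:
  "sets (discrete_measure w y) = sets borel"
  by (simp add: discrete_measure_def)

lemma borel_measurable_poly [measurable]: "poly p \<in> borel_measurable (borel :: real measure)"
  by (intro borel_measurable_continuous_onI continuous_intros)

lemma nn_integral_discrete_measure:
  assumes w: "\<And>k. 0 \<le> w k" and [measurable]: "g \<in> borel_measurable borel" and g: "\<And>x. 0 \<le> g x"
  shows "(\<integral>\<^sup>+x. ennreal (g x) \<partial>discrete_measure w y) = (\<Sum>k. ennreal (w k * g (y k)))"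
  unfolding discrete_measure_def
  by (subst nn_integral_distr)
     (auto simp: nn_integral_density nn_integral_count_space_nat w g ennreal_mult')

lemma integrable_discrete_measure_iff:
  fixes g :: "real \<Rightarrow> real"
  assumes w: "\<And>k. 0 \<le> w k" and [measurable]: "g \<in> borel_measurable borel"
  shows "integrable (discrete_measure w y) g \<longleftrightarrow> summable (\<lambda>k. \<bar>w k * g (y k)\<bar>)"
  unfolding discrete_measure_def
  by (subst integrable_distr_eq) (auto simp: integrable_density w integrable_count_space_nat_iff)

lemma integral_discrete_measure:
  fixes g :: "real \<Rightarrow> real"
  assumes w: "\<And>k. 0 \<le> w k" and [measurable]: "g \<in> borel_measurable borel"
    and s: "summable (\<lambda>k. \<bar>w k * g (y k)\<bar>)"
  shows "(LINT x|discrete_measure w y. g x) = (\<Sum>k. w k * g (y k))"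
  unfolding discrete_measure_def
  using s
  by (subst integral_distr) (auto simp: integral_density w integral_count_space_nat integrable_count_space_nat_iff)

text \<open>The map sending \<open>f\<close> to the sequence \<open>sqrt (w k) * f (y k)\<close> is
  an isometry from square-integrable functions into square-summable sequences, and takes the
  normalised polynomials to the rows of \<open>V\<close>. Orthogonality and density are thus read
  off from \<open>V\<close>.\<close>

lemma extremal_discrete_measure:
  fixes P :: "nat \<Rightarrow> real poly"
  assumes w: "\<And>k. 0 < w k" and h: "\<And>n. 0 < h n"
    and V: "\<And>n k. V n k = sqrt (w k / h n) * poly (P n) (y k)"
    and orth: "\<And>m n. (\<lambda>k. V m k * V n k) sums (if m = n then 1 else 0)"
    and dense: "\<And>f \<epsilon>. summable (\<lambda>k. (f k)\<^sup>2) \<Longrightarrow> \<epsilon> > 0 \<Longrightarrow>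
       \<exists>N c s. (\<lambda>k. (f k - (\<Sum>n<N. c n * V n k))\<^sup>2) sums s \<and> s < \<epsilon>"
  shows "(\<lambda>k. w k * poly (P m) (y k) * poly (P n) (y k)) sums (h m * (if m = n then 1 else 0))"
    and "extremal (discrete_measure w y) P"
proof -
  have w0: "0 \<le> w k" for k using w[of k] by simp
  have ww: "sqrt (w k) * sqrt (w k) = w k" for k using w0 by simp
  show s: "(\<lambda>k. w k * poly (P m) (y k) * poly (P n) (y k)) sums (h m * (if m = n then 1 else 0))" for m n
  proof -
    have "(\<lambda>k. sqrt (h m) * sqrt (h n) * (V m k * V n k)) sums (sqrt (h m) * sqrt (h n) * (if m = n then 1 else 0))"
      by (intro sums_mult orth)
    moreover have "sqrt (h m) * sqrt (h n) * (V m k * V n k) = w k * poly (P m) (y k) * poly (P n) (y k)" for k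
      using h[of m] h[of n] ww[of k] by (simp add: V real_sqrt_divide)
    moreover have "sqrt (h m) * sqrt (h n) * (if m = n then 1 else 0) = h m * (if m = n then 1 else 0)"
      using h[of n] by simp
    ultimately show ?thesis by simp
  qed
  \<comment> \<open>Integrability needs absolute convergence; the mixed products are dominated by
    the diagonal series, whose terms are nonnegative.\<close>
  have abs: "summable (\<lambda>k. \<bar>w k * (poly (P m) (y k) * poly (P n) (y k))\<bar>)" for m n
  proof (rule summable_comparison_test')
    show "summable (\<lambda>k. w k * poly (P m) (y k) * poly (P m) (y k) + w k * poly (P n) (y k) * poly (P n) (y k))"
      by (intro summable_add sums_summable[OF s])
    fix k
    have "\<bar>u * v\<bar> \<le> u * u + v * v" for u v :: real
      using sum_squares_bound[of u v] sum_squares_bound[of u "-v"] 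
      by (auto simp: power2_eq_square abs_if)
    from mult_left_mono[OF this w0[of k], of "poly (P m) (y k)" "poly (P n) (y k)"]
    show "norm \<bar>w k * (poly (P m) (y k) * poly (P n) (y k))\<bar> \<le> w k * poly (P m) (y k) * poly (P m) (y k) + w k * poly (P n) (y k) * poly (P n) (y k)"
      using w0[of k] by (simp add: abs_mult algebra_simps)
  qed
  have int: "(LINT x|discrete_measure w y. poly (P m) x * poly (P n) x) = h m * (if m = n then 1 else 0)" for m n
    using sums_unique[OF s[of m n]]
    by (subst integral_discrete_measure[where w = w and y = y and g = "\<lambda>x. poly (P m) x * poly (P n) x", OF w0 _ abs])
       (auto simp: mult_ac)
  have om: "orthogonality_measure (discrete_measure w y) P"
    unfolding orthogonality_measure_def power2_eq_square int
    using h by (auto simp: discrete_measure_space integrable_discrete_measure_iff[OF w0] abs)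
  show "extremal (discrete_measure w y) P"
    unfolding extremal_def
  proof (intro conjI om ballI allI impI)
    fix f :: "real \<Rightarrow> real" and \<epsilon> :: real
    assume "f \<in> borel_measurable (discrete_measure w y)"
      and fint: "integrable (discrete_measure w y) (\<lambda>y. (f y)\<^sup>2)" and eps: "0 < \<epsilon>"
    then have [measurable]: "f \<in> borel_measurable borel"
      by (simp add: discrete_measure_def)
    have "summable (\<lambda>k. \<bar>w k * (f (y k))\<^sup>2\<bar>)"
      using fint by (subst (asm) integrable_discrete_measure_iff[OF w0]) auto
    then have "summable (\<lambda>k. (sqrt (w k) * f (y k))\<^sup>2)"
      using w0 by (simp add: power_mult_distrib)
    from dense[OF this eps] obtain N c s
      where c: "(\<lambda>k. (sqrt (w k) * f (y k) - (\<Sum>n<N. c n * V n k))\<^sup>2) sums s" "s < \<epsilon>" by blast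
    \<comment> \<open>Undoes the normalisation of the \<open>n\<close>-th row, so that
      \<open>sqrt (w k)\<close> factors out of the whole residual.\<close>
    define d where "d n = c n / sqrt (h n)" for n
    have eq: "(sqrt (w k) * f (y k) - (\<Sum>n<N. c n * V n k))\<^sup>2 = w k * (f (y k) - (\<Sum>n<N. d n * poly (P n) (y k)))\<^sup>2" for k
    proof -
      have "sqrt (w k) * f (y k) - (\<Sum>n<N. c n * V n k) = sqrt (w k) * (f (y k) - (\<Sum>n<N. d n * poly (P n) (y k)))"
        by (simp add: V d_def real_sqrt_divide algebra_simps sum_distrib_left)
      then show ?thesis using w0 by (simp add: power_mult_distrib)
    qed
    have "(\<integral>\<^sup>+x. ennreal ((f x - (\<Sum>n<N. d n * poly (P n) x))\<^sup>2) \<partial>discrete_measure w y) =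
        (\<Sum>k. ennreal (w k * (f (y k) - (\<Sum>n<N. d n * poly (P n) (y k)))\<^sup>2))"
      by (rule nn_integral_discrete_measure[OF w0]) auto
    also have "\<dots> = ennreal s"
      using c(1) w0 unfolding eq by (intro suminf_ennreal_eq) auto
    also have "\<dots> < ennreal \<epsilon>"
      using c(2) eps by (simp add: ennreal_lessI)
    finally show "\<exists>N c. (\<integral>\<^sup>+x. ennreal ((f x - (\<Sum>n<N. c n * poly (P n) x))\<^sup>2) \<partial>discrete_measure w y) < ennreal \<epsilon>"
      by blast
  qed
qed

section \<open>Shifted factorials\<close>

lemma qpoch_Suc: "qpoch b p (Suc m) = qpoch b p m * (1 - b * p ^ m)" for b p :: real
  by (simp add: qpoch_def)

lemma qpoch_0 [simp]: "qpoch b p 0 = 1" for b p :: real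
  by (simp add: qpoch_def)

lemma qpoch_neg_pos: "0 \<le> b \<Longrightarrow> 0 \<le> p \<Longrightarrow> 0 < qpoch (- b) p n" for b p :: real
  unfolding qpoch_def by (intro prod_pos) (simp add: add_pos_nonneg)

lemma qpoch_convergent_prod:
  fixes b p :: real
  assumes "0 \<le> p" "p < 1"
  shows "convergent_prod (\<lambda>j. 1 - b * p ^ j)"
proof (rule abs_convergent_prod_imp_convergent_prod[OF summable_imp_abs_convergent_prod])
  show "summable (\<lambda>j. norm (1 - b * p ^ j - 1))"
    using assms by (simp add: abs_mult power_abs)
qed

lemma qpoch_tendsto_qpoch_inf:
  assumes "0 \<le> p" "p < 1"
  shows "qpoch b p \<longlonglongrightarrow> qpoch_inf b p"
  using has_prod_imp_tendsto'[OF convergent_prod_has_prod[OF qpoch_convergent_prod[OF assms]]]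
  unfolding qpoch_def qpoch_inf_def .

section \<open>The three-term recurrence\<close>

locale dual_q_ultraspherical =
  fixes a q :: real
  assumes q_pos: "0 < q" and q_less_1: "q < 1" and a_pos: "0 < a"
begin

text \<open>With \<open>u = q ^ m\<close>, the values at \<open>mu a q m\<close> as functions of \<open>x = q ^ n\<close> satisfy
  \<open>x * R m x = A u * R (m + 1) x + C u * R (m - 1) x\<close>.  There is no diagonal term, so \<open>R m\<close>
  has the parity of \<open>m\<close>.\<close>

definition A :: "real \<Rightarrow> real" where "A u = u * (1 + a * q * u) / (1 + a * q * u\<^sup>2)"
definition C :: "real \<Rightarrow> real" where "C u = (1 - u) / (1 + a * q * u\<^sup>2)"

text \<open>The second equation is the recurrence at \<open>m = 0\<close>, because
  \<open>A 1 = 1\<close> and \<open>C 1 = 0\<close>; the third is the recurrence solved for its top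
  term.\<close>

fun R :: "nat \<Rightarrow> real \<Rightarrow> real" where
  "R 0 x = 1"
| "R (Suc 0) x = x"
| "R (Suc (Suc m)) x = (x * R (Suc m) x - C (q ^ Suc m) * R m x) / A (q ^ Suc m)"

lemma one_plus_pos: "0 \<le> u \<Longrightarrow> 0 < 1 + a * q * u"
  using q_pos a_pos by (intro add_pos_nonneg) auto

lemma A_pos: "0 < u \<Longrightarrow> 0 < A u"
  using one_plus_pos[of u] one_plus_pos[of "u\<^sup>2"] by (simp add: A_def)

lemma R_rec: "x * R (Suc m) x = A (q ^ Suc m) * R (Suc (Suc m)) x + C (q ^ Suc m) * R m x"
  using A_pos[of "q ^ Suc m"] q_pos by (simp add: field_simps)

section \<open>Newton expansion at the nodes \<open>q^i\<close> and duality\<close>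

definition newton :: "nat \<Rightarrow> real \<Rightarrow> real" where
  "newton j x = (\<Prod>i<j. x - q ^ i)"

text \<open>\<open>P u j\<close> is the product of \<open>(q^-m;q)_j\<close> and \<open>(-aq^(m+1);q)_j\<close> at \<open>u = q^m\<close>.  A real \<open>u\<close> lets the
  recurrence be stated at \<open>m = 0\<close> as well, where \<open>C u = 0\<close>.\<close>

definition P :: "real \<Rightarrow> nat \<Rightarrow> real" where
  "P u j = (\<Prod>i<j. (1 - q ^ i / u) * (1 + a * u * q ^ Suc i))"

text \<open>The factor of the \<open>j\<close>-th term of the hypergeometric sum that is free of
  \<open>n\<close>: the rest, \<open>(q^-n;q)_j * (-q^(n+1))^j\<close>, equals
  \<open>(-q)^j * newton j (q^n)\<close>, and its power of \<open>-q\<close> is absorbed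
  here.\<close>

definition newton_coeff :: "real \<Rightarrow> nat \<Rightarrow> real" where
  "newton_coeff u j = (- q) ^ j * P u j / (qpoch (- a * q\<^sup>2) (q\<^sup>2) j * qpoch q q j)"

lemma qpoch_q_pos: "0 < qpoch (q ^ Suc l) (q ^ Suc m) n"
  unfolding qpoch_def
proof (intro prod_pos)
  fix i
  have "q ^ Suc l * (q ^ Suc m) ^ i = q ^ Suc (l + Suc m * i)"
    unfolding power_mult[symmetric] power_add[symmetric] by simp
  also have "\<dots> < 1" using q_pos q_less_1 by (intro power_Suc_less_one) auto
  finally show "0 < 1 - q ^ Suc l * (q ^ Suc m) ^ i" by simp
qed

lemma qpoch_q_gt_0: "0 < qpoch q q n" "0 < qpoch (q\<^sup>2) (q\<^sup>2) n" "0 < qpoch q (q\<^sup>2) n"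
  using qpoch_q_pos[of 0 0 n] qpoch_q_pos[of 1 1 n] qpoch_q_pos[of 0 1 n] by (simp_all add: power2_eq_square)

lemma P_0 [simp]: "P u 0 = 1" by (simp add: P_def)

lemma P_Suc: "P u (Suc i) = P u i * ((1 - q ^ i / u) * (1 + a * u * q ^ Suc i))"
  by (simp add: P_def)

text \<open>Replacing \<open>u\<close> by \<open>q * u\<close> shifts the index in both families of
  factors, in opposite directions, so only factors at the ends change; \<open>1 + a * q * u\<close>
  supplies the missing first factor. \<open>P_shift_down\<close> is the mirror image.\<close>

lemma P_shift_up:
  assumes "0 < u"
  shows "(1 + a * q * u) * P (q * u) (Suc i) =
    P u i * ((1 - 1 / (q * u)) * (1 + a * u * q ^ Suc i) * (1 + a * u * q ^ Suc (Suc i)))"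
proof (induction i)
  case 0
  then show ?case by (simp add: P_Suc mult_ac)
next
  case (Suc i)
  have e: "q ^ Suc i / (q * u) = q ^ i / u" using q_pos by simp
  have "(1 + a * q * u) * P (q * u) (Suc (Suc i))
     = ((1 + a * q * u) * P (q * u) (Suc i)) * ((1 - q ^ i / u) * (1 + a * (q * u) * q ^ Suc (Suc i)))"
    by (subst P_Suc) (simp only: e mult.assoc)
  then show ?case
    unfolding Suc by (subst P_Suc) (simp add: mult_ac)
qed

lemma P_shift_down:
  assumes "0 < u"
  shows "(1 - 1 / u) * P (u / q) (Suc i) =
    P u i * ((1 - q ^ i / u) * (1 - q ^ Suc i / u) * (1 + a * u))"
proof (induction i)
  case 0
  then show ?case using q_pos by (simp add: P_Suc mult_ac)
next
  case (Suc i)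
  have e: "q ^ Suc i / (u / q) = q ^ Suc (Suc i) / u" "a * (u / q) * q ^ Suc (Suc i) = a * u * q ^ Suc i"
    using q_pos by simp_all
  have "(1 - 1 / u) * P (u / q) (Suc (Suc i))
     = ((1 - 1 / u) * P (u / q) (Suc i)) * ((1 - q ^ Suc (Suc i) / u) * (1 + a * u * q ^ Suc i))"
    by (subst P_Suc) (simp only: e mult.assoc[symmetric])
  then show ?case
    unfolding Suc by (subst P_Suc) (simp only: mult_ac)
qed

text \<open>This is what remains of \<open>newton_coeff_recurrence\<close> after division by
  \<open>newton_coeff u i\<close>, with \<open>w = q^i\<close>. Multiplication by
  \<open>X * Y * u\<close> turns it into a polynomial identity.\<close>

lemma newton_coeff_recurrence_identity:
  fixes u w :: real
  assumes u: "0 < u" and nz: "1 + a * q * u\<^sup>2 \<noteq> 0" "1 + a * q\<^sup>2 * w\<^sup>2 \<noteq> 0" "1 - q * w \<noteq> 0"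
  shows "1 + q * w * (- q * ((1 - w / u) * (1 + a * u * (q * w))) / ((1 + a * q\<^sup>2 * w\<^sup>2) * (1 - q * w)))
    = - q * (u / (1 + a * q * u\<^sup>2) * ((1 - 1 / (q * u)) * (1 + a * u * (q * w)) * (1 + a * u * (q * (q * w))))
        - u / (1 + a * q * u\<^sup>2) * ((1 - w / u) * (1 - q * w / u) * (1 + a * u))) / ((1 + a * q\<^sup>2 * w\<^sup>2) * (1 - q * w))"
    (is "?l = ?r")
proof -
  define X where "X = 1 + a * q * u\<^sup>2"
  define Y where "Y = (1 + a * q\<^sup>2 * w\<^sup>2) * (1 - q * w)"
  have Y: "Y \<noteq> 0" and X: "X \<noteq> 0" using nz by (auto simp: X_def Y_def)
  have un: "u \<noteq> 0" and qn: "q \<noteq> 0" using u q_pos by auto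
  have "?l * (X * Y * u) = (Y * u - q * q * w * ((u - w) * (1 + a * u * (q * w)))) * X"
    using X Y un unfolding Y_def[symmetric] by (simp add: field_simps)
  also have "\<dots> = - (u * ((q * u - 1) * (1 + a * u * (q * w)) * (1 + a * u * (q * (q * w))))
        - q * ((u - w) * (u - q * w) * (1 + a * u)))"
    unfolding X_def Y_def by (simp add: algebra_simps power2_eq_square)
  also have "\<dots> = ?r * (X * Y * u)"
    using X Y un qn unfolding Y_def[symmetric] X_def[symmetric] by (simp add: field_simps)
  finally show ?thesis using X Y un by (simp only: mult_cancel_right mult_eq_0_iff simp_thms)
qed

text \<open>Comparison of the coefficients of \<open>newton (Suc i)\<close> in the three-term
  recurrence, where \<open>x * newton j x = newton (Suc j) x + q^j * newton j x\<close>.\<close>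

lemma newton_coeff_recurrence:
  assumes u: "0 < u"
  shows "newton_coeff u i + q ^ Suc i * newton_coeff u (Suc i) = A u * newton_coeff (q * u) (Suc i) + C u * newton_coeff (u / q) (Suc i)"
proof -
  define E where "E = qpoch (- a * q\<^sup>2) (q\<^sup>2) i"
  define G where "G = qpoch q q i"
  define w where "w = q ^ i"
  have ES: "qpoch (- a * q\<^sup>2) (q\<^sup>2) (Suc i) = E * (1 + a * q\<^sup>2 * w\<^sup>2)"
    by (simp add: E_def w_def qpoch_Suc mult.commute flip: power_mult)
  have GS: "qpoch q q (Suc i) = G * (1 - q * w)"
    by (simp add: G_def w_def qpoch_Suc)
  have G: "G \<noteq> 0" and E: "E \<noteq> 0"
    using qpoch_q_gt_0(1)[of i] qpoch_neg_pos[of "a * q\<^sup>2" "q\<^sup>2" i] a_pos by (auto simp: G_def E_def)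
  have nz: "1 + a * q * u\<^sup>2 \<noteq> 0" "1 + a * q\<^sup>2 * w\<^sup>2 \<noteq> 0" "1 - q * w \<noteq> 0"
    using one_plus_pos[of "u\<^sup>2"] one_plus_pos[of "q * w\<^sup>2"] power_Suc_less_one[of q i] q_pos q_less_1
    by (auto simp: w_def power2_eq_square mult_ac)
  define D where "D = (- q) ^ i * P u i / (E * G)"
  have 0: "newton_coeff u i = D" by (simp add: newton_coeff_def D_def E_def G_def)
  have 1: "newton_coeff u (Suc i) = D * (- q * ((1 - w / u) * (1 + a * u * (q * w))) / ((1 + a * q\<^sup>2 * w\<^sup>2) * (1 - q * w)))"
    unfolding newton_coeff_def ES GS P_Suc D_def w_def by (simp add: mult_ac)
  have "A u * P (q * u) (Suc i) = u / (1 + a * q * u\<^sup>2) * ((1 + a * q * u) * P (q * u) (Suc i))"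
    by (simp add: A_def)
  also note P_shift_up[OF u]
  finally have A: "A u * P (q * u) (Suc i) = P u i * (u / (1 + a * q * u\<^sup>2) * ((1 - 1 / (q * u)) * (1 + a * u * (q * w)) * (1 + a * u * (q * (q * w)))))"
    by (simp add: w_def mult_ac)
  \<comment> \<open>Writing \<open>1 - u\<close> as \<open>- u * (1 - 1 / u)\<close> produces the
    prefactor required by \<open>P_shift_down\<close>.\<close>
  have "C u * P (u / q) (Suc i) = - (u / (1 + a * q * u\<^sup>2)) * ((1 - 1 / u) * P (u / q) (Suc i))"
  proof -
    have "- u * (1 - 1 / u) = 1 - u" using u by (simp add: field_simps)
    then show ?thesis unfolding C_def by (metis mult.assoc minus_divide_left times_divide_eq_left)
  qed
  also note P_shift_down[OF u]
  finally have C: "C u * P (u / q) (Suc i) = - (P u i * (u / (1 + a * q * u\<^sup>2) * ((1 - w / u) * (1 - q * w / u) * (1 + a * u))))"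
    by (simp add: w_def mult_ac)
  have "A u * newton_coeff (q * u) (Suc i) + C u * newton_coeff (u / q) (Suc i) =
     (- q) ^ Suc i * (A u * P (q * u) (Suc i) + C u * P (u / q) (Suc i)) / (E * G * ((1 + a * q\<^sup>2 * w\<^sup>2) * (1 - q * w)))"
    unfolding newton_coeff_def ES GS by (simp only: add_divide_distrib distrib_left times_divide_eq_right mult_ac)
  also have "\<dots> = D * (- q * (u / (1 + a * q * u\<^sup>2) * ((1 - 1 / (q * u)) * (1 + a * u * (q * w)) * (1 + a * u * (q * (q * w))))
        - u / (1 + a * q * u\<^sup>2) * ((1 - w / u) * (1 - q * w / u) * (1 + a * u))) / ((1 + a * q\<^sup>2 * w\<^sup>2) * (1 - q * w)))"
  proof -
    have "(- q) ^ Suc i * (p * x + - (p * y)) / (E * G * z) = (- q) ^ i * p / (E * G) * (- q * (x - y) / z)"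
      for p x y z :: real
      by (simp add: algebra_simps diff_divide_distrib add_divide_distrib)
    then show ?thesis unfolding A C D_def .
  qed
  also have "\<dots> = D * (1 + q * w * (- q * ((1 - w / u) * (1 + a * u * (q * w))) / ((1 + a * q\<^sup>2 * w\<^sup>2) * (1 - q * w))))"
    by (subst newton_coeff_recurrence_identity[OF u nz]) (rule refl)
  also have "\<dots> = newton_coeff u i + q ^ Suc i * newton_coeff u (Suc i)"
    unfolding 0 1 w_def[symmetric] power_Suc by (simp only: distrib_left mult_1_right mult.left_commute)
  finally show ?thesis by simp
qed

text \<open>Stopping at \<open>n\<close> loses nothing, since \<open>newton j (q^n) = 0\<close> for
  \<open>j > n\<close>.\<close>

definition newton_sum :: "nat \<Rightarrow> real \<Rightarrow> real" where
  "newton_sum n u = (\<Sum>j\<le>n. newton_coeff u j * newton j (q ^ n))"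

lemma newton_sum_recurrence:
  assumes u: "0 < u"
  shows "q ^ n * newton_sum n u = A u * newton_sum n (q * u) + C u * newton_sum n (u / q)"
proof -
  let ?x = "q ^ n"
  have z: "newton (Suc n) ?x = 0" by (simp add: newton_def)
  \<comment> \<open>The vanishing term \<open>j = Suc n\<close> is added and the term
    \<open>j = 0\<close> split off, so that all sums run over \<open>newton (Suc j)\<close>.\<close>
  have ext: "newton_sum n v = newton_coeff v 0 + (\<Sum>j\<le>n. newton_coeff v (Suc j) * newton (Suc j) ?x)" for v
  proof -
    have "newton_sum n v = (\<Sum>j\<le>Suc n. newton_coeff v j * newton j ?x)" by (simp add: newton_sum_def z)
    then show ?thesis by (subst (asm) sum.atMost_Suc_shift) (simp add: newton_def)
  qed
  have d0: "newton_coeff v 0 = 1" for v by (simp add: newton_coeff_def)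
  \<comment> \<open>The comparison of coefficients at \<open>newton 0\<close>, where every
    \<open>newton_coeff v 0\<close> is 1.\<close>
  have AC: "A u + C u = 1"
    using one_plus_pos[of "u\<^sup>2"]
    by (simp add: A_def C_def add_divide_distrib[symmetric]) (simp add: algebra_simps power2_eq_square)
  have nw: "?x * newton j ?x = newton (Suc j) ?x + q ^ j * newton j ?x" for j
    by (simp add: newton_def algebra_simps)
  have "?x * newton_sum n u = (\<Sum>j\<le>n. newton_coeff u j * (?x * newton j ?x))"
    by (simp add: newton_sum_def sum_distrib_left mult_ac)
  also have "\<dots> = (\<Sum>j\<le>n. newton_coeff u j * newton (Suc j) ?x) + (\<Sum>j\<le>n. q ^ j * newton_coeff u j * newton j ?x)"
    unfolding nw by (simp add: distrib_left sum.distrib mult_ac)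
  also have "(\<Sum>j\<le>n. q ^ j * newton_coeff u j * newton j ?x) = (\<Sum>j\<le>Suc n. q ^ j * newton_coeff u j * newton j ?x)"
    by (simp add: z)
  also have "\<dots> = 1 + (\<Sum>j\<le>n. q ^ Suc j * newton_coeff u (Suc j) * newton (Suc j) ?x)"
    by (subst sum.atMost_Suc_shift) (simp add: newton_def d0)
  finally have "?x * newton_sum n u = 1 + (\<Sum>j\<le>n. (newton_coeff u j + q ^ Suc j * newton_coeff u (Suc j)) * newton (Suc j) ?x)"
    by (simp only: distrib_right sum.distrib) 
  also have "\<dots> = A u + C u + (\<Sum>j\<le>n. (A u * newton_coeff (q * u) (Suc j) + C u * newton_coeff (u / q) (Suc j)) * newton (Suc j) ?x)"
    unfolding newton_coeff_recurrence[OF u] AC ..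
  also have "\<dots> = A u * newton_sum n (q * u) + C u * newton_sum n (u / q)"
    unfolding ext d0 by (simp add: distrib_left distrib_right sum.distrib sum_distrib_left mult_ac)
  finally show ?thesis .
qed

text \<open>Both sides satisfy the same recurrence in \<open>m\<close>. The initial value is 1
  because \<open>P 1 j\<close> contains the factor \<open>1 - 1\<close> for
  \<open>j > 0\<close>.\<close>

lemma newton_sum_eq_R: "newton_sum n (q ^ m) = R m (q ^ n)"
proof (induction m rule: less_induct)
  case (less m)
  have S1: "newton_sum n 1 = 1"
  proof -
    have "newton_coeff 1 j = 0" if "0 < j" for j
    proof -
      have "P 1 j = 0" unfolding P_def using that by (intro prod_zero) (auto intro!: bexI[of _ 0])
      then show ?thesis by (simp add: newton_coeff_def)
    qed
    then have "newton_sum n 1 = (\<Sum>j\<in>{0}. newton_coeff 1 j * newton j (q ^ n))"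
      unfolding newton_sum_def by (intro sum.mono_neutral_right) auto
    then show ?thesis by (simp add: newton_coeff_def newton_def)
  qed
  show ?case
  proof (cases "m = 0 \<or> m = Suc 0")
    case True
    \<comment> \<open>For \<open>m = 1\<close> the recurrence is used at \<open>u = 1\<close>, where
      \<open>C 1 = 0\<close> discards the value at \<open>1 / q\<close>.\<close>
    then show ?thesis using newton_sum_recurrence[of 1 n] one_plus_pos[of 1]
      by (auto simp: S1 A_def C_def)
  next
    case False
    then obtain k where 3: "m = Suc (Suc k)"
      by (metis not0_implies_Suc)
    have "q ^ n * newton_sum n (q ^ Suc k) = A (q ^ Suc k) * newton_sum n (q ^ Suc (Suc k)) + C (q ^ Suc k) * newton_sum n (q ^ k)"
      using newton_sum_recurrence[of "q ^ Suc k" n] q_pos by simp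
    moreover have "newton_sum n (q ^ Suc k) = R (Suc k) (q ^ n)" "newton_sum n (q ^ k) = R k (q ^ n)"
      using less.IH[of "Suc k"] less.IH[of k] 3 by simp_all
    ultimately show ?thesis
      using A_pos[of "q ^ Suc k"] q_pos 3 by (simp add: field_simps)
  qed
qed

text \<open>The duality that exchanges degree and node: at \<open>mu a q m\<close> the defining sum
  agrees term by term with the Newton sum at \<open>q^n\<close>.\<close>

lemma poly_dualD_mu: "poly (dualD a q n) (mu a q (real m)) = R m (q ^ n)"
proof -
  have m: "mu a q (real m) = 1 / q ^ m - a * q * q ^ m"
    using q_pos by (simp add: mu_def powr_minus powr_add powr_realpow divide_inverse)
  have P: "(\<Prod>i<j. 1 - a * q ^ (2 * i + 1) - q ^ i * mu a q (real m)) = P (q ^ m) j" for j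
    unfolding P_def
  proof (intro prod.cong refl)
    fix i
    have "q ^ (2 * i + 1) = q * (q ^ i * q ^ i)" by (simp add: mult_2 power_add)
    then show "1 - a * q ^ (2 * i + 1) - q ^ i * mu a q (real m) = (1 - q ^ i / q ^ m) * (1 + a * q ^ m * q ^ Suc i)"
      using q_pos unfolding m by (simp add: field_simps)
  qed
  have N: "qpoch (q powi - int n) q j * (- (q ^ (n + 1))) ^ j = (- q) ^ j * newton j (q ^ n)" for j
  proof -
    have "(1 - q powi - int n * q ^ i) * - (q ^ (n + 1)) = - q * (q ^ n - q ^ i)" for i
      using q_pos by (simp add: power_int_minus field_simps)
    then have "(\<Prod>i<j. (1 - q powi - int n * q ^ i) * - (q ^ (n + 1))) = (\<Prod>i<j. - q * (q ^ n - q ^ i))"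
      by (simp only:)
    then show ?thesis by (simp only: prod.distrib prod_constant card_lessThan qpoch_def newton_def)
  qed
  have "poly (dualD_expl a q n) (mu a q (real m)) = (\<Sum>j\<le>n. (qpoch (q powi - int n) q j * (- (q ^ (n + 1))) ^ j) *
       P (q ^ m) j / (qpoch (- a * q\<^sup>2) (q\<^sup>2) j * qpoch q q j))"
    unfolding dualD_expl_def P[symmetric] by (simp add: poly_sum poly_prod mult_ac)
  also have "\<dots> = newton_sum n (q ^ m)"
    unfolding N newton_sum_def newton_coeff_def by (simp add: mult_ac)
  finally show ?thesis
    using dualD_eq_expl[OF q_pos q_less_1 a_pos] newton_sum_eq_R by simp
qed

section \<open>Moments and orthogonality in the dual variable\<close>

lemma q2_power: "(q\<^sup>2) ^ n = q ^ n * q ^ n"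
  by (simp add: power2_eq_square power_mult_distrib)

lemma q2_power': "- a * q\<^sup>2 * (q\<^sup>2) ^ n = - a * q ^ (2 * Suc n)" "q\<^sup>2 * (q\<^sup>2) ^ n = q ^ (2 * Suc n)"
  by (simp_all only: power_mult mult.assoc power_Suc)

text \<open>Up to the constant \<open>moment 0 0\<close>, the reciprocal of the squared norm in the
  theorem; see \<open>norm_eq\<close>.\<close>

definition mass :: "nat \<Rightarrow> real" where
  "mass n = q ^ n * qpoch (- a * q\<^sup>2) (q\<^sup>2) n / qpoch (q\<^sup>2) (q\<^sup>2) n"

lemma mass_0: "mass 0 = 1" by (simp add: mass_def)

lemma mass_pos: "0 < mass n"
  using q_pos a_pos qpoch_q_gt_0(2)[of n] qpoch_neg_pos[of "a * q\<^sup>2" "q\<^sup>2" n] by (simp add: mass_def)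

lemma one_minus_q_pos: "0 < 1 - q ^ Suc i"
  using power_Suc_less_one[OF q_pos q_less_1, of i] by simp

text \<open>The Pearson equation of the masses. It drives both the ratio test and the recursion of
  the moments.\<close>

lemma mass_Suc: "mass (Suc n) * (1 - q ^ (2 * Suc n)) = mass n * (q * (1 + a * q ^ (2 * Suc n)))"
proof -
  have "1 - q ^ (2 * Suc n) \<noteq> 0" using one_minus_q_pos[of "Suc (2 * n)"] by simp
  then show ?thesis
    using qpoch_q_gt_0(2)[of n]
    unfolding mass_def qpoch_Suc q2_power' by (simp add: divide_simps)
qed

lemma summable_mass: "summable mass"
proof -
  define r where "r n = q * (1 + a * q ^ (2 * Suc n)) / (1 - q ^ (2 * Suc n))" for n
  have S: "mass (Suc n) = r n * mass n" for n
    using mass_Suc[of n] one_minus_q_pos[of "Suc (2 * n)"] by (simp add: r_def field_simps)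
  have "(\<lambda>n. q ^ (2 * Suc n)) \<longlonglongrightarrow> 0"
    using q_pos q_less_1 by (intro LIMSEQ_power_zero[THEN filterlim_compose] filterlim_subseq) (auto simp: strict_mono_def)
  \<comment> \<open>The ratios tend to \<open>q\<close>, so \<open>(1 + q) / 2\<close>, which lies
    between \<open>q\<close> and 1, bounds them eventually.\<close>
  then have "r \<longlonglongrightarrow> q * (1 + a * 0) / (1 - 0)"
    unfolding r_def by (intro tendsto_intros) auto
  then have "\<forall>\<^sub>F n in sequentially. r n < (1 + q) / 2"
    using q_less_1 by (intro order_tendstoD) auto
  then obtain N where N: "\<And>n. n \<ge> N \<Longrightarrow> r n < (1 + q) / 2"
    by (auto simp: eventually_sequentially)
  show ?thesis
  proof (rule summable_ratio_test[of "(1 + q) / 2" N])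
    fix n assume "N \<le> n"
    from N[OF this] show "norm (mass (Suc n)) \<le> (1 + q) / 2 * norm (mass n)"
      using mass_pos[of n] mass_pos[of "Suc n"] by (simp add: S mult_right_mono)
  qed (use q_less_1 in auto)
qed

definition q_int :: "(real \<Rightarrow> real) \<Rightarrow> real" where "q_int f = (\<Sum>n. mass n * f (q ^ n))"

text \<open>The nodes \<open>q^n\<close> tend to 0, so continuity there bounds \<open>f\<close> on
  all of them, and the masses are summable.\<close>

lemma q_int_sums:
  assumes "isCont f 0"
  shows "(\<lambda>n. mass n * f (q ^ n)) sums q_int f"
proof -
  have "(\<lambda>n. q ^ n) \<longlonglongrightarrow> 0" using q_pos q_less_1 by (intro LIMSEQ_power_zero) auto
  then have "(\<lambda>n. f (q ^ n)) \<longlonglongrightarrow> f 0" by (rule isCont_tendsto_compose[OF assms])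
  then have "Bseq (\<lambda>n. f (q ^ n))" by (intro convergent_imp_Bseq convergentI)
  then obtain B where B: "\<And>n. norm (f (q ^ n)) \<le> B" by (auto simp: Bseq_def)
  have "summable (\<lambda>n. mass n * f (q ^ n))"
  proof (rule summable_comparison_test')
    show "summable (\<lambda>n. mass n * B)" by (intro summable_mult2 summable_mass)
    show "norm (mass n * f (q ^ n)) \<le> mass n * B" for n
      using B[of n] mass_pos[of n] by (simp add: abs_mult mult_left_mono)
  qed
  then show ?thesis unfolding q_int_def by (rule summable_sums)
qed

lemma q_int_linear:
  assumes "isCont f 0" "isCont g 0"
  shows "q_int (\<lambda>x. c * f x + e * g x) = c * q_int f + e * q_int g"
proof -
  have "(\<lambda>n. c * (mass n * f (q ^ n)) + e * (mass n * g (q ^ n))) sums (c * q_int f + e * q_int g)"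
    by (intro sums_add sums_mult q_int_sums assms)
  then show ?thesis
    unfolding q_int_def by (intro sums_unique[symmetric]) (simp add: algebra_simps)
qed

lemma isCont_R [continuous_intros]: "isCont (R m) x"
proof (induction m rule: less_induct)
  case (less m)
  show ?case
  proof (cases "m = 0 \<or> m = Suc 0")
    case True
    then have "R m = (\<lambda>x. 1) \<or> R m = (\<lambda>x. x)" by auto
    then show ?thesis by auto
  next
    case False
    then obtain k where k: "m = Suc (Suc k)" by (metis not0_implies_Suc)
    have "R m = (\<lambda>x. (x * R (Suc k) x - C (q ^ Suc k) * R k x) / A (q ^ Suc k))"
      by (simp add: k fun_eq_iff)
    moreover have "isCont (R k) x" "isCont (R (Suc k)) x" using less.IH k by auto
    ultimately show ?thesis
      using A_pos[of "q ^ Suc k"] q_pos by (simp only:) (intro continuous_intros, auto)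
  qed
qed

lemma C_1: "C 1 = 0" by (simp add: C_def)

text \<open>At \<open>m = 0\<close> truncated subtraction turns \<open>R (m - 1)\<close> into
  \<open>R 0\<close>, but its coefficient is \<open>C 1 = 0\<close>.\<close>

lemma R_rec': "x * R m x = A (q ^ m) * R (Suc m) x + C (q ^ m) * R (m - 1) x"
proof (cases m)
  case 0
  then show ?thesis using one_plus_pos[of 1] by (simp add: A_def C_def)
next
  case (Suc k)
  show ?thesis unfolding Suc diff_Suc_1 by (rule R_rec)
qed

section \<open>Closed form of the moments\<close>

definition moment :: "nat \<Rightarrow> nat \<Rightarrow> real" where "moment l m = q_int (\<lambda>x. x ^ l * R m x)"

text \<open>The functional equation behind the \<open>q\<close>-binomial theorem.\<close>

lemma moment_0_rec: "moment l 0 * (1 - q ^ Suc l) = moment (l + 2) 0 * (1 + a * q ^ (l + 3))"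
proof -
  have moment: "moment k 0 = q_int (\<lambda>x. x ^ k)" for k by (simp add: moment_def)
  have s: "(\<lambda>n. mass n * (q ^ n) ^ k) sums moment k 0" for k
    unfolding moment by (intro q_int_sums continuous_intros)
  then have s': "(\<lambda>n. mass (Suc n) * (q ^ Suc n) ^ k) sums (moment k 0 - mass 0 * (q ^ 0) ^ k)" for k
    using sums_Suc_iff[of "\<lambda>n. mass n * (q ^ n) ^ k" "moment k 0 - mass 0 * (q ^ 0) ^ k" for k] by simp
  have 1: "(\<lambda>n. mass (Suc n) * (q ^ Suc n) ^ l - mass (Suc n) * (q ^ Suc n) ^ (l + 2)) sums
      ((moment l 0 - mass 0 * (q ^ 0) ^ l) - (moment (l + 2) 0 - mass 0 * (q ^ 0) ^ (l + 2)))"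
    by (intro sums_diff s')
  have 2: "(\<lambda>n. q ^ Suc l * (mass n * (q ^ n) ^ l) + a * q ^ (l + 3) * (mass n * (q ^ n) ^ (l + 2))) sums
      (q ^ Suc l * moment l 0 + a * q ^ (l + 3) * moment (l + 2) 0)"
    by (intro sums_add sums_mult s)
  \<comment> \<open>The Pearson equation \<open>mass_Suc\<close> multiplied by
    \<open>(q^Suc n)^l\<close>.\<close>
  have 3: "mass (Suc n) * (q ^ Suc n) ^ l - mass (Suc n) * (q ^ Suc n) ^ (l + 2)
      = q ^ Suc l * (mass n * (q ^ n) ^ l) + a * q ^ (l + 3) * (mass n * (q ^ n) ^ (l + 2))" for n
  proof -
    have "(q ^ Suc n) ^ 2 = q ^ (2 * Suc n)" by (metis power_mult mult.commute)
    then have "mass (Suc n) * (q ^ Suc n) ^ l - mass (Suc n) * (q ^ Suc n) ^ (l + 2)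
      = (q ^ Suc n) ^ l * (mass (Suc n) * (1 - q ^ (2 * Suc n)))"
      by (simp only: power_add) (simp add: algebra_simps)
    also have "\<dots> = q ^ Suc l * (mass n * (q ^ n) ^ l) + a * q ^ (l + 3) * (mass n * (q ^ n) ^ (l + 2))"
      unfolding mass_Suc by (simp add: algebra_simps power_add power_mult_distrib power2_eq_square power3_eq_cube mult_2 mult_2_right)
    finally show ?thesis .
  qed
  \<comment> \<open>The terms at \<open>n = 0\<close> are both 1 and cancel.\<close>
  have "(moment l 0 - mass 0 * (q ^ 0) ^ l) - (moment (l + 2) 0 - mass 0 * (q ^ 0) ^ (l + 2))
      = q ^ Suc l * moment l 0 + a * q ^ (l + 3) * moment (l + 2) 0"
    by (rule sums_unique2[OF 1[unfolded 3] 2])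
  then show ?thesis by (simp add: algebra_simps)
qed

lemma moment_0_even: "moment (2 * i) 0 = moment 0 0 * qpoch q (q\<^sup>2) i / qpoch (- a * q ^ 3) (q\<^sup>2) i"
proof (induction i)
  case (Suc i)
  have "(q\<^sup>2) ^ i = q ^ (2 * i)" by (simp add: power_mult)
  moreover have "0 < 1 + a * q ^ (2 * i + 3)" using a_pos q_pos by (intro add_pos_nonneg) auto
  moreover have "moment (2 * Suc i) 0 * (1 + a * q ^ (2 * i + 3)) = moment (2 * i) 0 * (1 - q ^ Suc (2 * i))"
    using moment_0_rec[of "2 * i"] by simp
  ultimately have "moment (2 * Suc i) 0 = moment (2 * i) 0 * (1 - q * (q\<^sup>2) ^ i) / (1 - (- a * q ^ 3) * (q\<^sup>2) ^ i)"
    by (simp add: field_simps power_add power3_eq_cube)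
  then show ?case unfolding Suc qpoch_Suc by simp
qed simp

text \<open>The constant is found by letting the exponent grow. All nodes but \<open>x = 1\<close>
  are at most \<open>q\<close>, so \<open>moment l 0\<close> tends to \<open>mass 0 = 1\<close>,
  while the products in \<open>moment_0_even\<close> tend to their infinite counterparts.\<close>

lemma moment_0_0: "moment 0 0 = qpoch_inf (- a * q ^ 3) (q\<^sup>2) / qpoch_inf q (q\<^sup>2)"
proof -
  have q2: "0 \<le> q\<^sup>2" "q\<^sup>2 < 1" using q_pos q_less_1 by (auto intro: power_Suc_less_one simp: abs_square_less_1)
  have c: "moment l 0 = (\<Sum>n. mass (Suc n) * (q ^ Suc n) ^ l) + 1" and s: "summable (\<lambda>n. mass (Suc n) * (q ^ Suc n) ^ l)" for l
  proof -
    have "(\<lambda>n. mass n * (q ^ n) ^ l) sums moment l 0"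
      using q_int_sums[of "\<lambda>x. x ^ l"] by (simp add: moment_def)
    then have "(\<lambda>n. mass (Suc n) * (q ^ Suc n) ^ l) sums (moment l 0 - 1)"
      using sums_Suc_iff[of "\<lambda>n. mass n * (q ^ n) ^ l" "moment l 0 - 1"] by (simp add: mass_0)
    then show "moment l 0 = (\<Sum>n. mass (Suc n) * (q ^ Suc n) ^ l) + 1" "summable (\<lambda>n. mass (Suc n) * (q ^ Suc n) ^ l)"
      by (auto simp: sums_iff)
  qed
  have le: "moment l 0 - 1 \<le> q ^ l * (\<Sum>n. mass (Suc n))" for l
  proof -
    have sv: "summable (\<lambda>n. mass (Suc n))" using summable_mass by (subst summable_Suc_iff)
    have "(\<Sum>n. mass (Suc n) * (q ^ Suc n) ^ l) \<le> (\<Sum>n. q ^ l * mass (Suc n))"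
    proof (intro suminf_le s summable_mult sv)
      fix n
      have "(q ^ Suc n) ^ l \<le> q ^ l"
        using q_pos q_less_1 by (intro power_mono) (auto intro: mult_left_le power_le_one)
      then show "mass (Suc n) * (q ^ Suc n) ^ l \<le> q ^ l * mass (Suc n)"
        using mass_pos[of "Suc n"] by (simp add: mult.commute)
    qed
    then show ?thesis unfolding c[of l] by (simp add: suminf_mult[OF sv])
  qed
  have ge: "0 \<le> moment l 0 - 1" for l
    using suminf_nonneg[OF s[of l]] mass_pos q_pos unfolding c[of l] by (simp add: less_imp_le)
  have "(\<lambda>l. moment l 0 - 1) \<longlonglongrightarrow> 0"
  proof (rule tendsto_sandwich[OF always_eventually always_eventually tendsto_const])
    have "(\<lambda>l. q ^ l * (\<Sum>n. mass (Suc n))) \<longlonglongrightarrow> 0 * (\<Sum>n. mass (Suc n))"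
      using q_pos q_less_1 by (intro tendsto_intros LIMSEQ_power_zero) auto
    then show "(\<lambda>l. q ^ l * (\<Sum>n. mass (Suc n))) \<longlonglongrightarrow> 0" by simp
  qed (use le ge in auto)
  then have "(\<lambda>l. moment l 0 - 1 + 1) \<longlonglongrightarrow> 0 + 1" by (intro tendsto_intros)
  then have "(\<lambda>l. moment l 0) \<longlonglongrightarrow> 1" by simp
  then have 1: "(\<lambda>i. moment (2 * i) 0) \<longlonglongrightarrow> 1"
    by (rule filterlim_compose) (auto intro!: filterlim_subseq simp: strict_mono_def)
  have pos: "qpoch_inf (- a * q ^ 3) (q\<^sup>2) \<noteq> 0"
    unfolding qpoch_inf_def
  proof (intro prodinf_nonzero qpoch_convergent_prod q2)
    fix i
    have "0 < 1 + a * q ^ 3 * (q\<^sup>2) ^ i" using a_pos q_pos by (intro add_pos_nonneg) auto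
    then show "1 - - a * q ^ 3 * (q\<^sup>2) ^ i \<noteq> 0" by simp
  qed
  have pos': "qpoch_inf q (q\<^sup>2) \<noteq> 0"
    unfolding qpoch_inf_def
  proof (intro prodinf_nonzero qpoch_convergent_prod q2)
    fix i
    show "1 - q * (q\<^sup>2) ^ i \<noteq> 0"
      using one_minus_q_pos[of "2 * i"] by (simp add: power_mult)
  qed
  have "(\<lambda>i. moment (2 * i) 0) \<longlonglongrightarrow> moment 0 0 * qpoch_inf q (q\<^sup>2) / qpoch_inf (- a * q ^ 3) (q\<^sup>2)"
    unfolding moment_0_even by (intro tendsto_intros qpoch_tendsto_qpoch_inf q2 pos)
  from LIMSEQ_unique[OF this 1] show ?thesis using pos pos' by (simp add: field_simps)
qed

lemma moment_0_0_pos: "0 < moment 0 0"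
proof -
  have "0 \<le> moment 0 0 - mass 0"
  proof -
    have s: "mass sums moment 0 0" using q_int_sums[of "\<lambda>x. 1"] by (simp add: moment_def)
    show ?thesis
      using sum_le_suminf[of mass "{0}"] s mass_pos by (auto simp: sums_iff less_imp_le)
  qed
  then show ?thesis by (simp add: mass_0)
qed

lemma moment_rec: "A (q ^ m) * moment l (Suc m) = moment (Suc l) m - C (q ^ m) * moment l (m - 1)"
proof -
  have "moment (Suc l) m = q_int (\<lambda>x. A (q ^ m) * (x ^ l * R (Suc m) x) + C (q ^ m) * (x ^ l * R (m - 1) x))"
  proof -
    have "x ^ Suc l * R m x = A (q ^ m) * (x ^ l * R (Suc m) x) + C (q ^ m) * (x ^ l * R (m - 1) x)" for x
      using arg_cong[OF R_rec'[of x m], of "\<lambda>y. x ^ l * y"] by (simp add: algebra_simps del: R.simps)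
    then show ?thesis by (simp only: moment_def)
  qed
  also have "\<dots> = A (q ^ m) * moment l (Suc m) + C (q ^ m) * moment l (m - 1)"
    unfolding moment_def by (intro q_int_linear continuous_intros)
  finally show ?thesis by simp
qed

text \<open>Found as the product solution of \<open>moment_rec\<close>; see \<open>moment_closed_form\<close>.\<close>

definition moment_val :: "nat \<Rightarrow> nat \<Rightarrow> real" where
  "moment_val s m = moment 0 0 * qpoch q q (m + 2 * s) / (qpoch (q\<^sup>2) (q\<^sup>2) s * qpoch (- a * q ^ 3) (q\<^sup>2) (m + s))"

lemma qpoch_even_split: "qpoch q q (2 * i) = qpoch q (q\<^sup>2) i * qpoch (q\<^sup>2) (q\<^sup>2) i"
proof (induction i)
  case (Suc i)
  have "qpoch q q (2 * Suc i) = qpoch q q (2 * i) * ((1 - q * q ^ (2 * i)) * (1 - q * q ^ Suc (2 * i)))"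
    by (simp add: qpoch_Suc)
  also have "(1 - q * q ^ (2 * i)) * (1 - q * q ^ Suc (2 * i)) = (1 - q * (q\<^sup>2) ^ i) * (1 - q\<^sup>2 * (q\<^sup>2) ^ i)"
    by (simp add: power_mult) (simp add: power2_eq_square)
  finally show ?case unfolding Suc qpoch_Suc by (simp only: mult_ac)
qed simp

lemma qpoch_neg_cube_pos: "0 < qpoch (- a * q ^ 3) (q\<^sup>2) i"
  using qpoch_neg_pos[of "a * q ^ 3" "q\<^sup>2" i] a_pos q_pos by simp

text \<open>\<open>moment_val_rec\<close> with the common factor removed, where
  \<open>u = q^(m+1)\<close> and \<open>\<sigma> = q^(2*s+2)\<close>.\<close>

lemma moment_val_identity:
  fixes u \<sigma> :: real
  assumes "1 - \<sigma> \<noteq> 0" "1 + a * q * u\<^sup>2 \<noteq> 0" "1 + a * q * u\<^sup>2 * \<sigma> \<noteq> 0"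
  shows "(1 - u * \<sigma>) / ((1 - \<sigma>) * (1 + a * q * u\<^sup>2 * \<sigma>)) - C u / (1 - \<sigma>) = A u / (1 + a * q * u\<^sup>2 * \<sigma>)"
proof -
  define X Y Z where "X = 1 + a * q * u\<^sup>2" and "Y = 1 + a * q * u\<^sup>2 * \<sigma>" and "Z = 1 - \<sigma>"
  have nz: "X \<noteq> 0" "Y \<noteq> 0" "Z \<noteq> 0" using assms by (auto simp: X_def Y_def Z_def)
  have "((1 - u * \<sigma>) / (Z * Y) - (1 - u) / X / Z) * (X * Y * Z) = (1 - u * \<sigma>) * X - (1 - u) * Y"
    using nz by (simp add: field_simps)
  also have "\<dots> = u * (1 + a * q * u) * Z"
    by (simp add: X_def Y_def Z_def algebra_simps power2_eq_square)
  also have "\<dots> = u * (1 + a * q * u) / X / Y * (X * Y * Z)"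
    using nz by (simp add: field_simps)
  finally show ?thesis
    using nz unfolding A_def C_def X_def[symmetric] Y_def[symmetric] Z_def[symmetric]
    by (simp only: mult_cancel_right mult_eq_0_iff simp_thms)
qed

text \<open>The counterpart of \<open>moment_rec\<close> at \<open>Suc m\<close> with
  \<open>l = m + 2 + 2 * s\<close>: both terms on its right then have excess
  \<open>2 * Suc s\<close> of exponent over index.\<close>

lemma moment_val_rec: "moment_val (Suc s) (Suc m) - C (q ^ Suc m) * moment_val (Suc s) m = A (q ^ Suc m) * moment_val s (Suc (Suc m))"
proof -
  define u where "u = q ^ Suc m"
  define \<sigma> where "\<sigma> = q ^ Suc (Suc (2 * s))"
  define X where "X = moment 0 0 * qpoch q q (Suc (Suc (m + 2 * s))) / (qpoch (q\<^sup>2) (q\<^sup>2) s * qpoch (- a * q ^ 3) (q\<^sup>2) (Suc (m + s)))"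
  have u\<sigma>: "1 - q * q ^ Suc (Suc (m + 2 * s)) = 1 - u * \<sigma>"
    by (simp add: u_def \<sigma>_def power_add mult_ac)
  have \<sigma>: "1 - q\<^sup>2 * (q\<^sup>2) ^ s = 1 - \<sigma>"
    unfolding \<sigma>_def q2_power' by simp
  have u2\<sigma>: "1 - (- a * q ^ 3) * (q\<^sup>2) ^ Suc (m + s) = 1 + a * q * u\<^sup>2 * \<sigma>"
    by (simp add: \<sigma>_def u_def power_mult power_add power2_eq_square power3_eq_cube power_mult_distrib mult_ac)
  have n1: "1 - \<sigma> \<noteq> 0" using one_minus_q_pos[of "Suc (2 * s)"] by (simp add: \<sigma>_def)
  have n2: "1 + a * q * u\<^sup>2 \<noteq> 0" using one_plus_pos[of "u\<^sup>2"] by simp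
  have n3: "1 + a * q * u\<^sup>2 * \<sigma> \<noteq> 0" using one_plus_pos[of "u\<^sup>2 * \<sigma>"] q_pos by (simp add: \<sigma>_def mult_ac)
  have i: "Suc m + 2 * Suc s = Suc (Suc (Suc (m + 2 * s)))" "m + 2 * Suc s = Suc (Suc (m + 2 * s))"
    "Suc (Suc m) + 2 * s = Suc (Suc (m + 2 * s))" "Suc m + Suc s = Suc (Suc (m + s))"
    "m + Suc s = Suc (m + s)" "Suc (Suc m) + s = Suc (Suc (m + s))" by auto
  have 1: "moment_val (Suc s) (Suc m) = X * ((1 - u * \<sigma>) / ((1 - \<sigma>) * (1 + a * q * u\<^sup>2 * \<sigma>)))"
    unfolding moment_val_def X_def i qpoch_Suc[of q q "Suc (Suc (m + 2 * s))"] qpoch_Suc[of "- a * q ^ 3" "q\<^sup>2" "Suc (m + s)"]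
      qpoch_Suc[of "q\<^sup>2" "q\<^sup>2" s] u\<sigma> \<sigma> u2\<sigma> by (simp add: mult_ac)
  have 2: "moment_val (Suc s) m = X * (1 / (1 - \<sigma>))"
    unfolding moment_val_def X_def i qpoch_Suc[of "q\<^sup>2" "q\<^sup>2" s] \<sigma> by (simp add: mult_ac)
  have 3: "moment_val s (Suc (Suc m)) = X * (1 / (1 + a * q * u\<^sup>2 * \<sigma>))"
    unfolding moment_val_def X_def i qpoch_Suc[of "- a * q ^ 3" "q\<^sup>2" "Suc (m + s)"] u2\<sigma> by (simp add: mult_ac)
  have "moment_val (Suc s) (Suc m) - C u * moment_val (Suc s) m = X * ((1 - u * \<sigma>) / ((1 - \<sigma>) * (1 + a * q * u\<^sup>2 * \<sigma>)) - C u / (1 - \<sigma>))"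
    unfolding 1 2 by (simp add: right_diff_distrib mult_ac)
  also have "\<dots> = A u * moment_val s (Suc (Suc m))"
    unfolding moment_val_identity[OF n1 n2 n3] 3 by simp
  finally show ?thesis by (simp only: u_def)
qed

text \<open>The boundary case of \<open>moment_rec\<close>: it makes the moment of
  \<open>x^m\<close> against \<open>R (m + 2)\<close> vanish.\<close>

lemma moment_val_0_rec: "moment_val 0 (Suc m) = C (q ^ Suc m) * moment_val 0 m"
proof -
  have e: "1 - (- a * q ^ 3) * (q\<^sup>2) ^ m = 1 + a * q * (q ^ Suc m)\<^sup>2"
    unfolding q2_power by (simp add: power2_eq_square power3_eq_cube)
  then show ?thesis
    by (simp only: moment_val_def C_def mult_0_right add_0_right qpoch_Suc e power_Suc) (simp add: mult_ac)
qed

text \<open>Two-step induction along \<open>moment_rec\<close>. Parity enters because the recursion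
  of the power moments moves in steps of two and only the even ones start from
  \<open>moment 0 0\<close>.\<close>

lemma moment_closed_form:
  "(\<forall>s. moment (m + 2 * s) m = moment_val s m) \<and> (\<forall>l<m. even (l + m) \<longrightarrow> moment l m = 0)"
proof (induction m rule: less_induct)
  case (less m)
  show ?case
  proof (cases "m = 0 \<or> m = Suc 0")
    case True
    then show ?thesis
    proof
      assume m: "m = 0"
      have "moment (2 * s) 0 = moment_val s 0" for s
        using qpoch_q_gt_0(2)[of s] unfolding moment_0_even moment_val_def by (simp add: qpoch_even_split)
      then show ?thesis using m by simp
    next
      assume m: "m = Suc 0"
      have "moment (Suc (2 * s)) (Suc 0) = moment_val s (Suc 0)" for s
      proof -
        \<comment> \<open>Since \<open>R 1 x = x\<close>, the case \<open>m = 1\<close> also reduces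
          to even power moments.\<close>
        have "moment (Suc (2 * s)) (Suc 0) = moment (2 * Suc s) 0" by (simp add: moment_def mult_ac)
        also have "\<dots> = moment_val s (Suc 0)"
        proof -
          have e: "qpoch q q (2 * Suc s) = qpoch q q (Suc (2 * s)) * (1 - q\<^sup>2 * (q\<^sup>2) ^ s)"
            unfolding q2_power' by (simp add: qpoch_Suc)
          have p: "0 < 1 - q\<^sup>2 * (q\<^sup>2) ^ s"
            using one_minus_q_pos[of "Suc (2 * s)"] unfolding q2_power' by simp
          have "moment (2 * Suc s) 0 = moment 0 0 * (qpoch q q (2 * Suc s) / qpoch (q\<^sup>2) (q\<^sup>2) (Suc s)) / qpoch (- a * q ^ 3) (q\<^sup>2) (Suc s)"
            using qpoch_q_gt_0(2)[of "Suc s"] unfolding moment_0_even by (simp only: qpoch_even_split) simp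
          also have "qpoch q q (2 * Suc s) / qpoch (q\<^sup>2) (q\<^sup>2) (Suc s) = qpoch q q (Suc (2 * s)) / qpoch (q\<^sup>2) (q\<^sup>2) s"
            using p unfolding e qpoch_Suc[of "q\<^sup>2" "q\<^sup>2" s] by simp
          finally show ?thesis by (simp add: moment_val_def)
        qed
        finally show ?thesis .
      qed
      then show ?thesis using m by auto
    qed
  next
    case False
    then obtain k where k: "m = Suc (Suc k)" by (metis not0_implies_Suc)
    have A0: "A (q ^ Suc k) \<noteq> 0" using A_pos[of "q ^ Suc k"] q_pos by simp
    have rec: "A (q ^ Suc k) * moment l m = moment (Suc l) (Suc k) - C (q ^ Suc k) * moment l k" for l
      using moment_rec[of "Suc k" l] by (simp add: k)
    have IH1: "moment (Suc k + 2 * s) (Suc k) = moment_val s (Suc k)" and IH2: "moment (k + 2 * s) k = moment_val s k" for s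
      using less.IH[of "Suc k"] less.IH[of k] k by auto
    have "moment (m + 2 * s) m = moment_val s m" for s
    proof -
      have "A (q ^ Suc k) * moment (m + 2 * s) m = moment_val (Suc s) (Suc k) - C (q ^ Suc k) * moment_val (Suc s) k"
        unfolding rec using IH1[of "Suc s"] IH2[of "Suc s"] by (simp add: k)
      then show ?thesis unfolding moment_val_rec using A0 by (simp add: k)
    qed
    moreover have "moment l m = 0" if l: "l < m" "even (l + m)" for l
    proof -
      have "moment (Suc l) (Suc k) - C (q ^ Suc k) * moment l k = 0"
      proof (cases "l < k")
        case True
        then have "moment (Suc l) (Suc k) = 0" "moment l k = 0"
          using less.IH[of "Suc k"] less.IH[of k] k l by auto
        then show ?thesis by simp
      next
        case False
        \<comment> \<open>The remaining value \<open>l = Suc k\<close> has the wrong parity.\<close>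
        then have "l = k" using l k by (cases "l = Suc k") auto
        then show ?thesis using IH1[of 0] IH2[of 0] by (simp add: moment_val_0_rec)
      qed
      then show ?thesis using rec[of l] A0 by simp
    qed
    ultimately show ?thesis by blast
  qed
qed

text \<open>The power \<open>x^l\<close> generalises the claim for induction: \<open>R_rec'\<close>
  trades \<open>R j\<close> for a further factor \<open>x\<close> and \<open>R (j - 1)\<close>, at
  the cost of a term with \<open>l + j\<close> lowered by 2. Below the diagonal everything vanishes;
  on it only the leading term survives, and each step contributes one factor
  \<open>A (q^i)\<close>.\<close>

lemma q_int_R_R:
  "(\<forall>l m. even (l + j + m) \<longrightarrow> l + j < m \<longrightarrow> q_int (\<lambda>x. x ^ l * (R j x * R m x)) = 0)
   \<and> (\<forall>l m. l + j = m \<longrightarrow> q_int (\<lambda>x. x ^ l * (R j x * R m x)) * (\<Prod>i<j. A (q ^ i)) = moment_val 0 m)"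
proof (induction j rule: less_induct)
  case (less j)
  define B where "B l j m = q_int (\<lambda>x. x ^ l * (R j x * R m x))" for l j m
  show ?case
  proof (cases j)
    case 0
    have "moment m m = moment_val 0 m" for m using moment_closed_form[of m] by (metis add.right_neutral mult_0_right)
    then show ?thesis using moment_closed_form by (simp add: 0 moment_def)
  next
    case (Suc i)
    have A0: "A (q ^ i) \<noteq> 0" using A_pos[of "q ^ i"] q_pos by simp
    have rec: "A (q ^ i) * B l j m = B (Suc l) i m - C (q ^ i) * B l (i - 1) m" for l m
    proof -
      have "x ^ Suc l * (R i x * R m x) = A (q ^ i) * (x ^ l * (R j x * R m x)) + C (q ^ i) * (x ^ l * (R (i - 1) x * R m x))" for x
        using arg_cong[OF R_rec'[of x i], of "\<lambda>y. x ^ l * y * R m x"] by (simp add: algebra_simps Suc del: R.simps)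
      then have "B (Suc l) i m = q_int (\<lambda>x. A (q ^ i) * (x ^ l * (R j x * R m x)) + C (q ^ i) * (x ^ l * (R (i - 1) x * R m x)))"
        by (simp only: B_def)
      also have "\<dots> = A (q ^ i) * B l j m + C (q ^ i) * B l (i - 1) m"
        unfolding B_def by (intro q_int_linear continuous_intros)
      finally show ?thesis by simp
    qed
    \<comment> \<open>Either \<open>i = 0\<close> and the coefficient is \<open>C 1 = 0\<close>, or
      \<open>l + (i - 1) = l + j - 2 < m\<close> and the induction hypothesis applies.\<close>
    have C0: "C (q ^ i) * B l (i - 1) m = 0" if "l + j \<le> m" "even (l + j + m)" for l m
    proof (cases i)
      case 0 then show ?thesis by (simp add: C_1)
    next
      case (Suc i')
      then show ?thesis using less.IH[of i'] that \<open>j = Suc i\<close> by (simp add: B_def)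
    qed
    have "B l j m = 0" if "even (l + j + m)" "l + j < m" for l m
    proof -
      have "B (Suc l) i m = 0"
        using less.IH[of i, THEN conjunct1, rule_format, of "Suc l" m] that Suc unfolding B_def by simp
      moreover have "C (q ^ i) * B l (i - 1) m = 0" using C0[of l m] that by simp
      ultimately have "A (q ^ i) * B l j m = 0" unfolding rec by simp
      then show ?thesis using A0 by simp
    qed
    moreover have "B l j m * (\<Prod>i<j. A (q ^ i)) = moment_val 0 m" if "l + j = m" for l m
    proof -
      have "B (Suc l) i m * (\<Prod>i<i. A (q ^ i)) = moment_val 0 m"
        using less.IH[of i, THEN conjunct2, rule_format, of "Suc l" m] that Suc unfolding B_def by simp
      moreover have "A (q ^ i) * B l j m = B (Suc l) i m" using rec[of l m] C0[of l m] that by simp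
      moreover have "B l j m * (\<Prod>i<j. A (q ^ i)) = (A (q ^ i) * B l j m) * (\<Prod>i<i. A (q ^ i))"
        by (simp add: Suc)
      ultimately show ?thesis by simp
    qed
    ultimately show ?thesis unfolding B_def by blast
  qed
qed

text \<open>Common form of the two weight sequences: at \<open>m = 2 * k\<close> and
  \<open>m = 2 * k + 1\<close> the exponent is \<open>k * (2 * k - 1)\<close> and
  \<open>k * (2 * k + 1)\<close>.\<close>

definition weight :: "nat \<Rightarrow> real" where
  "weight m = (1 + a * q ^ (2 * m + 1)) * qpoch (- a * q) q m / ((1 + a * q) * qpoch q q m) * q ^ (m * (m - 1) div 2)"

lemma weight_pos: "0 < weight m"
proof -
  have "0 < 1 + a * q ^ (2 * m + 1)" "0 < 1 + a * q"
    using a_pos q_pos by (auto intro!: add_pos_nonneg)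
  then show ?thesis
    unfolding weight_def using qpoch_q_gt_0(1)[of m] qpoch_neg_pos[of "a * q" q m] a_pos q_pos by simp
qed

text \<open>The denominators of the \<open>A (q^i)\<close> multiply to \<open>(-aq;q^2)_m\<close>;
  against \<open>(-aq^3;q^2)_m\<close> this telescopes to
  \<open>(1 + a * q^(2*m+1)) / (1 + a * q)\<close>.\<close>

lemma prod_A_eq: "(\<Prod>i<m. A (q ^ i)) * qpoch (- a * q ^ 3) (q\<^sup>2) m = qpoch q q m * weight m"
proof (induction m)
  case 0
  have "0 < 1 + a * q" using a_pos q_pos by (auto intro!: add_pos_nonneg)
  then show ?case by (simp add: weight_def)
next
  case (Suc m)
  define X where "X = qpoch (- a * q) q m / (1 + a * q) * q ^ (m * (m - 1) div 2)"
  have p: "0 < 1 + a * q ^ (2 * m + 1)" using a_pos q_pos by (auto intro!: add_pos_nonneg)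
  have e1: "Suc m * (Suc m - 1) = m * (m - 1) + m * 2" by (cases m) auto
  have e2: "Suc m * (Suc m - 1) div 2 = m * (m - 1) div 2 + m" unfolding e1 by (rule div_mult_self1[THEN trans]) auto
  have weight: "qpoch q q m * weight m = X * (1 + a * q ^ (2 * m + 1))"
    using qpoch_q_gt_0(1)[of m] by (simp add: weight_def X_def)
  have WS: "qpoch q q (Suc m) * weight (Suc m) = X * ((1 + a * q ^ (2 * m + 3)) * (1 + a * q ^ Suc m) * q ^ m)"
  proof -
    have "qpoch q q (Suc m) * weight (Suc m) = (1 + a * q ^ (2 * Suc m + 1)) * qpoch (- a * q) q (Suc m) / (1 + a * q) * q ^ (Suc m * (Suc m - 1) div 2)"
      using qpoch_q_gt_0(1)[of "Suc m"] by (simp add: weight_def)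
    then show ?thesis unfolding e2 by (simp add: X_def qpoch_Suc power_add eval_nat_numeral mult_ac)
  qed
  have A: "A (q ^ m) = q ^ m * (1 + a * q ^ Suc m) / (1 + a * q ^ (2 * m + 1))"
    by (simp add: A_def power_mult[symmetric] mult_ac)
  have E: "qpoch (- a * q ^ 3) (q\<^sup>2) (Suc m) = qpoch (- a * q ^ 3) (q\<^sup>2) m * (1 + a * q ^ (2 * m + 3))"
    by (simp add: qpoch_Suc power_mult[symmetric] power_add mult_ac)
  have "(\<Prod>i<Suc m. A (q ^ i)) * qpoch (- a * q ^ 3) (q\<^sup>2) (Suc m)
    = ((\<Prod>i<m. A (q ^ i)) * qpoch (- a * q ^ 3) (q\<^sup>2) m) * (A (q ^ m) * (1 + a * q ^ (2 * m + 3)))"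
    unfolding E by simp
  also have "\<dots> = qpoch q q (Suc m) * weight (Suc m)"
    unfolding Suc weight WS A using p by simp
  finally show ?case .
qed

lemma R_orthogonal:
  assumes "even (m + m')"
  shows "(\<lambda>n. mass n * (R m (q ^ n) * R m' (q ^ n))) sums (if m = m' then moment 0 0 / weight m else 0)"
proof -
  have s: "(\<lambda>n. mass n * (R m (q ^ n) * R m' (q ^ n))) sums q_int (\<lambda>x. R m x * R m' x)"
    by (intro q_int_sums continuous_intros)
  have lt: "q_int (\<lambda>x. R j x * R k x) = 0" if "j < k" "even (j + k)" for j k
    using q_int_R_R[of j] that by (metis (no_types, lifting) add_0 mult_1 power_0 q_int_def suminf_cong)
  consider "m < m'" | "m' < m" | "m = m'" by linarith
  then have "q_int (\<lambda>x. R m x * R m' x) = (if m = m' then moment 0 0 / weight m else 0)"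
  proof cases
    case 1 then show ?thesis using lt assms by simp
  next
    case 2
    then have "q_int (\<lambda>x. R m' x * R m x) = 0" using lt[of m' m] assms by (simp add: add.commute)
    then show ?thesis using 2 by (simp add: mult.commute)
  next
    case 3
    have "q_int (\<lambda>x. R m x * R m x) * (\<Prod>i<m. A (q ^ i)) = moment_val 0 m"
      using q_int_R_R[of m, THEN conjunct2, rule_format, of 0 m] by simp
    then have "q_int (\<lambda>x. R m x * R m x) * ((\<Prod>i<m. A (q ^ i)) * qpoch (- a * q ^ 3) (q\<^sup>2) m) = moment 0 0 * qpoch q q m"
      using qpoch_neg_cube_pos[of m] by (simp add: moment_val_def field_simps)
    then show ?thesis
      unfolding prod_A_eq using 3 weight_pos[of m] qpoch_q_gt_0(1)[of m] by (simp add: field_simps)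
  qed
  then show ?thesis using s by simp
qed

section \<open>Completeness and transposition\<close>

text \<open>Being inductive, it gives closure properties by rule induction;
  \<open>parity_span_expand\<close> recovers explicit coefficients.\<close>

inductive parity_span :: "nat \<Rightarrow> (real \<Rightarrow> real) \<Rightarrow> bool" for p where
  parity_span_0: "parity_span p (\<lambda>x. 0)"
| parity_span_add_R: "parity_span p f \<Longrightarrow> parity_span p (\<lambda>x. f x + c * R (2 * k + p) x)"

lemma parity_span_R: "parity_span p (\<lambda>x. c * R (2 * k + p) x)"
  using parity_span_add_R[OF parity_span_0, of p c k] by simp

lemma parity_span_add: "parity_span p g \<Longrightarrow> parity_span p f \<Longrightarrow> parity_span p (\<lambda>x. f x + g x)"
  by (induction rule: parity_span.induct) (auto simp: add.assoc[symmetric] intro: parity_span_add_R)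

lemma parity_span_scale: "parity_span p f \<Longrightarrow> parity_span p (\<lambda>x. c * f x)"
  by (induction rule: parity_span.induct) (auto simp: distrib_left mult.assoc[symmetric] intro: parity_span.intros)

text \<open>Two applications of \<open>R_rec'\<close> change the index by -2, 0 or 2, so
  multiplication by \<open>x^2\<close> preserves parity.\<close>

lemma square_mult_R:
  assumes "p < 2"
  shows "\<exists>c1 c2 c3. \<forall>x. x\<^sup>2 * R (2 * k + p) x =
    c1 * R (2 * Suc k + p) x + c2 * R (2 * k + p) x + c3 * R (2 * (k - 1) + p) x"
proof -
  define m where "m = 2 * k + p"
  \<comment> \<open>For \<open>k = 0\<close> the index \<open>m\<close> is 0 or 1, so one of the two
    factors is \<open>C 1 = 0\<close> and truncated subtraction does no harm.\<close>
  have s: "C (q ^ m) * C (q ^ (m - 1)) * R (m - 1 - 1) x = C (q ^ m) * C (q ^ (m - 1)) * R (2 * (k - 1) + p) x" for x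
  proof (cases k)
    case 0
    then have "m = 0 \<or> m = 1" using assms by (auto simp: m_def)
    then show ?thesis using C_1 by auto
  qed (simp add: m_def)
  have t: "C (q ^ m) * (A (q ^ (m - 1)) * R (Suc (m - 1)) x) = C (q ^ m) * A (q ^ (m - 1)) * R m x" for x
    by (cases m) (use C_1 in auto)
  have "x\<^sup>2 * R m x = A (q ^ m) * A (q ^ Suc m) * R (2 * Suc k + p) x
     + (A (q ^ m) * C (q ^ Suc m) + C (q ^ m) * A (q ^ (m - 1))) * R m x
     + C (q ^ m) * C (q ^ (m - 1)) * R (2 * (k - 1) + p) x" for x
  proof -
    have "x\<^sup>2 * R m x = A (q ^ m) * (x * R (Suc m) x) + C (q ^ m) * (x * R (m - 1) x)"
      using arg_cong[OF R_rec'[of x m], of "\<lambda>y. x * y"] by (simp add: power2_eq_square algebra_simps del: R.simps)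
    also have "\<dots> = A (q ^ m) * (A (q ^ Suc m) * R (Suc (Suc m)) x + C (q ^ Suc m) * R m x)
        + (C (q ^ m) * (A (q ^ (m - 1)) * R (Suc (m - 1)) x) + C (q ^ m) * C (q ^ (m - 1)) * R (m - 1 - 1) x)"
      unfolding R_rec'[of x "Suc m"] R_rec'[of x "m - 1"] by (simp add: distrib_left mult.assoc del: R.simps)
    also have "Suc (Suc m) = 2 * Suc k + p" by (simp add: m_def)
    finally show ?thesis
      unfolding s t by (simp add: algebra_simps del: R.simps)
  qed
  then show ?thesis unfolding m_def by blast
qed

lemma parity_span_mult:
  assumes p: "p < 2" and f: "parity_span p f"
  shows "parity_span p (\<lambda>x. f x * (\<alpha> + \<beta> * x\<^sup>2))"
proof -
  have "parity_span p (\<lambda>x. x\<^sup>2 * f x)"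
    using f
  proof (induction rule: parity_span.induct)
    case parity_span_0 then show ?case by (simp add: parity_span.parity_span_0)
  next
    case (parity_span_add_R f c k)
    obtain c1 c2 c3 where "\<And>x. x\<^sup>2 * R (2 * k + p) x =
      c1 * R (2 * Suc k + p) x + c2 * R (2 * k + p) x + c3 * R (2 * (k - 1) + p) x"
      using square_mult_R[OF p] by blast
    then have e: "x\<^sup>2 * (f x + c * R (2 * k + p) x) = x\<^sup>2 * f x +
      c * (c1 * R (2 * Suc k + p) x + c2 * R (2 * k + p) x + c3 * R (2 * (k - 1) + p) x)" for x
      by (simp only: distrib_left mult.left_commute)
    show ?case unfolding e by (intro parity_span_add parity_span_scale parity_span_R parity_span_add_R.IH)
  qed
  then have "parity_span p (\<lambda>x. \<alpha> * f x + \<beta> * (x\<^sup>2 * f x))" by (intro parity_span_add parity_span_scale f)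
  then show ?thesis by (simp add: algebra_simps)
qed

lemma parity_span_prod:
  assumes p: "p < 2" and J: "finite J"
  shows "parity_span p (\<lambda>x. x ^ p * (\<Prod>j\<in>J. \<alpha> j + \<beta> j * x\<^sup>2))"
  using J
proof (induction J)
  case empty
  have "x ^ p = 1 * R (2 * 0 + p) x" for x using p by (cases p) (auto simp: less_2_cases_iff)
  then have "parity_span p (\<lambda>x. x ^ p)" using parity_span_R[of p 1 0] by (simp only:)
  then show ?case by simp
next
  case (insert j J)
  have "parity_span p (\<lambda>x. (x ^ p * (\<Prod>j\<in>J. \<alpha> j + \<beta> j * x\<^sup>2)) * (\<alpha> j + \<beta> j * x\<^sup>2))"
    by (intro parity_span_mult p insert.IH)
  then show ?case using insert.hyps by (simp add: mult_ac)
qed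

lemma parity_span_expand: "parity_span p f \<Longrightarrow> \<exists>N c. \<forall>x. f x = (\<Sum>k<N. c k * R (2 * k + p) x)"
proof -
  assume "parity_span p f"
  \<comment> \<open>Strengthened to all longer sums, so that a further term with any index can be
    accommodated.\<close>
  then have "\<exists>N c. (\<forall>M\<ge>N. \<forall>x. f x = (\<Sum>k<M. c k * R (2 * k + p) x))"
  proof (induction rule: parity_span.induct)
    case parity_span_0
    show ?case by (intro exI[of _ 0] exI[of _ "\<lambda>_. 0"]) simp
  next
    case (parity_span_add_R f c0 i)
    then obtain N c where c: "\<And>M x. M \<ge> N \<Longrightarrow> f x = (\<Sum>k<M. c k * R (2 * k + p) x)" by blast
    have "f x + c0 * R (2 * i + p) x = (\<Sum>k<M. (c k + (if k = i then c0 else 0)) * R (2 * k + p) x)"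
      if "M \<ge> max N (Suc i)" for M x
    proof -
      have "(\<Sum>k<M. (if k = i then c0 else 0) * R (2 * k + p) x) = (\<Sum>k<M. if k = i then c0 * R (2 * i + p) x else 0)"
        by (intro sum.cong) auto
      also have "\<dots> = c0 * R (2 * i + p) x" using that by simp
      finally show ?thesis using c[of M x] that by (simp add: distrib_right sum.distrib)
    qed
    then show ?case
      by (intro exI[of _ "max N (Suc i)"] exI[of _ "\<lambda>k. c k + (if k = i then c0 else 0)"]) blast
  qed
  then show ?thesis by blast
qed

section \<open>Lagrange interpolation of fixed parity\<close>

text \<open>Interpolation in the variable \<open>x^2\<close>, with \<open>x^p\<close> in front: the
  parity is that of \<open>p\<close>, and the zeros sit at \<open>q^j\<close> and
  \<open>- q^j\<close>.\<close>

definition lagrange :: "nat \<Rightarrow> nat \<Rightarrow> nat \<Rightarrow> real \<Rightarrow> real" where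
  "lagrange p n N x = (x / q ^ n) ^ p * (\<Prod>j\<in>{..<N} - {n}. (1 - x\<^sup>2 / (q ^ j)\<^sup>2) / (1 - (q ^ n)\<^sup>2 / (q ^ j)\<^sup>2))"

lemma q_power_eq_iff: "q ^ i = q ^ j \<longleftrightarrow> i = j"
  using q_pos q_less_1 by (metis linorder_neqE_nat order_less_irrefl power_strict_decreasing)

lemma lagrange_denominator: "j \<noteq> n \<Longrightarrow> 1 - (q ^ n)\<^sup>2 / (q ^ j)\<^sup>2 \<noteq> 0"
  using q_pos q_power_eq_iff[of n j] by (auto simp: power2_eq_iff_nonneg)

lemma parity_span_lagrange: "p < 2 \<Longrightarrow> parity_span p (lagrange p n N)"
proof -
  assume p: "p < 2"
  define D where "D j = 1 - (q ^ n)\<^sup>2 / (q ^ j)\<^sup>2" for j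
  have "parity_span p (\<lambda>x. (1 / (q ^ n) ^ p) * (x ^ p * (\<Prod>j\<in>{..<N} - {n}. 1 / D j + (- (1 / ((q ^ j)\<^sup>2 * D j))) * x\<^sup>2)))"
    by (intro parity_span_scale parity_span_prod p) auto
  moreover have "1 / D j + (- (1 / ((q ^ j)\<^sup>2 * D j))) * x\<^sup>2 = (1 - x\<^sup>2 / (q ^ j)\<^sup>2) / D j" for j x
    by (simp add: diff_divide_distrib)
  ultimately show ?thesis
    unfolding lagrange_def D_def[symmetric] by (simp add: power_divide)
qed

lemma lagrange_self: "lagrange p n N (q ^ n) = 1"
proof -
  have "(\<Prod>j\<in>{..<N} - {n}. (1 - (q ^ n)\<^sup>2 / (q ^ j)\<^sup>2) / (1 - (q ^ n)\<^sup>2 / (q ^ j)\<^sup>2)) = 1"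
    using lagrange_denominator by (intro prod.neutral) auto
  then show ?thesis using q_pos by (simp add: lagrange_def)
qed

lemma lagrange_zero: "j < N \<Longrightarrow> j \<noteq> n \<Longrightarrow> lagrange p n N (q ^ j) = 0"
  unfolding lagrange_def using q_pos by (auto intro!: bexI[of _ j])

text \<open>At the nodes beyond \<open>N\<close> every numerator factor lies in \<open>[0, 1]\<close>, while the denominators grow.\<close>

lemma lagrange_bounded: "\<exists>B N0. \<forall>N\<ge>N0. \<forall>l\<ge>N. \<bar>lagrange p n N (q ^ l)\<bar> \<le> B"
proof -
  define E where "E N = (\<Prod>j\<in>{..<N} - {n}. \<bar>1 - (q ^ n)\<^sup>2 / (q ^ j)\<^sup>2\<bar>)" for N
  have E_pos: "0 < E N" for N
    unfolding E_def using lagrange_denominator by (intro prod_pos) auto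
  have "(\<lambda>N. q ^ N) \<longlonglongrightarrow> 0" using q_pos q_less_1 by (intro LIMSEQ_power_zero) auto
  then have "\<forall>\<^sub>F N in sequentially. q ^ N < q ^ n / 2"
    using q_pos by (intro order_tendstoD) auto
  \<comment> \<open>Past \<open>N0\<close> one has \<open>(q^n / q^N)^2 >= 4\<close>, so each new
    denominator factor exceeds 1 in absolute value.\<close>
  then obtain N0 where N0: "\<And>N. N \<ge> N0 \<Longrightarrow> q ^ N < q ^ n / 2" by (auto simp: eventually_sequentially)
  have E_mono: "E N0 \<le> E N" if "N \<ge> N0" for N
    using that
  proof (induction N rule: dec_induct)
    case (step N)
    have b: "q ^ N < q ^ n / 2" using N0 step by auto
    have "N \<noteq> n"
    proof
      assume "N = n"
      then show False using b q_pos by simp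
    qed
    then have "{..<Suc N} - {n} = insert N ({..<N} - {n})" by auto
    then have ES: "E (Suc N) = \<bar>1 - (q ^ n)\<^sup>2 / (q ^ N)\<^sup>2\<bar> * E N" by (simp add: E_def)
    have "2 \<le> q ^ n / q ^ N" using b q_pos by (simp add: field_simps)
    then have "2\<^sup>2 \<le> (q ^ n / q ^ N)\<^sup>2" by (intro power_mono) auto
    then have "1 \<le> \<bar>1 - (q ^ n)\<^sup>2 / (q ^ N)\<^sup>2\<bar>" by (simp add: power_divide)
    then have "1 * E N \<le> E (Suc N)" unfolding ES using E_pos[of N] by (intro mult_right_mono) auto
    then show ?case using step.IH by simp
  qed simp
  have "\<bar>lagrange p n N (q ^ l)\<bar> \<le> (1 / q ^ n) ^ p / E N0" if N: "N \<ge> N0" and l: "l \<ge> N" for N l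
  proof -
    have "\<bar>\<Prod>j\<in>{..<N} - {n}. 1 - (q ^ l)\<^sup>2 / (q ^ j)\<^sup>2\<bar> \<le> 1"
      unfolding abs_prod
    proof (intro prod_le_1 conjI)
      fix j assume "j \<in> {..<N} - {n}"
      then have "q ^ l \<le> q ^ j" using l q_pos q_less_1 by (intro power_decreasing) auto
      then have "(q ^ l)\<^sup>2 \<le> (q ^ j)\<^sup>2" using q_pos by (intro power_mono) auto
      then have "(q ^ l)\<^sup>2 / (q ^ j)\<^sup>2 \<le> 1" "0 \<le> (q ^ l)\<^sup>2 / (q ^ j)\<^sup>2" using q_pos by auto
      then show "\<bar>1 - (q ^ l)\<^sup>2 / (q ^ j)\<^sup>2\<bar> \<le> 1" by linarith
    qed auto
    moreover have "\<bar>(q ^ l / q ^ n) ^ p\<bar> \<le> (1 / q ^ n) ^ p"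
      using q_pos q_less_1 by (simp add: power_abs) (intro power_mono divide_right_mono, auto intro: power_le_one)
    moreover have "\<bar>lagrange p n N (q ^ l)\<bar> = \<bar>(q ^ l / q ^ n) ^ p\<bar> * (\<bar>\<Prod>j\<in>{..<N} - {n}. 1 - (q ^ l)\<^sup>2 / (q ^ j)\<^sup>2\<bar> / E N)"
      unfolding lagrange_def E_def by (simp add: abs_mult abs_prod prod_dividef)
    ultimately have "\<bar>lagrange p n N (q ^ l)\<bar> \<le> (1 / q ^ n) ^ p * (1 / E N)"
      using E_pos[of N] q_pos by (simp only:) (intro mult_mono divide_right_mono, auto)
    also have "\<dots> \<le> (1 / q ^ n) ^ p * (1 / E N0)"
      using E_pos[of N0] E_mono[OF N] q_pos by (intro mult_left_mono divide_left_mono) auto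
    finally show ?thesis by simp
  qed
  then show ?thesis by blast
qed

section \<open>The unitary matrix and its transpose\<close>

definition V :: "nat \<Rightarrow> nat \<Rightarrow> nat \<Rightarrow> real" where
  "V p k n = sqrt (mass n * weight (2 * k + p) / moment 0 0) * R (2 * k + p) (q ^ n)"

lemma V_orthonormal: "(\<lambda>n. V p k n * V p k' n) sums (if k = k' then 1 else 0)"
proof -
  define w where "w i = sqrt (weight (2 * i + p) / moment 0 0)" for i
  have w2: "w i * w i = weight (2 * i + p) / moment 0 0" for i
    using weight_pos[of "2 * i + p"] moment_0_0_pos by (simp add: w_def)
  have V: "V p i n = sqrt (mass n) * w i * R (2 * i + p) (q ^ n)" for i n
    unfolding V_def w_def by (simp add: real_sqrt_mult real_sqrt_divide)
  have "(\<lambda>n. w k * w k' * (mass n * (R (2 * k + p) (q ^ n) * R (2 * k' + p) (q ^ n)))) sums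
      (w k * w k' * (if 2 * k + p = 2 * k' + p then moment 0 0 / weight (2 * k + p) else 0))"
    by (intro sums_mult R_orthogonal) simp
  moreover have "w k * w k' * (mass n * (R (2 * k + p) (q ^ n) * R (2 * k' + p) (q ^ n))) = V p k n * V p k' n" for n
    using mass_pos[of n] unfolding V
    by (subst real_sqrt_mult_self[of "mass n", simplified abs_of_pos[OF mass_pos], symmetric]) (simp only: mult_ac)
  moreover have "w k * w k' * (if 2 * k + p = 2 * k' + p then moment 0 0 / weight (2 * k + p) else 0) = (if k = k' then 1 else 0)"
    using w2[of k] weight_pos[of "2 * k + p"] moment_0_0_pos by (cases "k = k'") auto
  ultimately show ?thesis by simp
qed

text \<open>The unit vector at \<open>n\<close> is approximated by
  \<open>sqrt (mass j / mass n)\<close> times the Lagrange polynomial at \<open>q^j\<close>. This is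
  exact for \<open>j < N\<close>, and the squared error beyond is at most a constant times a tail of
  the masses.\<close>

lemma V_complete:
  assumes p: "p < 2" and eps: "0 < \<epsilon>"
  shows "\<exists>I c s. (\<lambda>j. ((if j = n then 1 else 0) - (\<Sum>i<I. c i * V p i j))\<^sup>2) sums s \<and> s < \<epsilon>"
proof -
  obtain B N0 where B: "\<And>N l. N \<ge> N0 \<Longrightarrow> l \<ge> N \<Longrightarrow> \<bar>lagrange p n N (q ^ l)\<bar> \<le> B"
    using lagrange_bounded by metis
  have "(\<lambda>N. B\<^sup>2 / mass n * (\<Sum>j. mass (j + N))) \<longlonglongrightarrow> B\<^sup>2 / mass n * 0"
    by (intro tendsto_mult tendsto_const suminf_exist_split2 summable_mass)
  then have "\<forall>\<^sub>F N in sequentially. B\<^sup>2 / mass n * (\<Sum>j. mass (j + N)) < \<epsilon>"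
    using eps by (intro order_tendstoD) auto
  then obtain N1 where N1: "\<And>N. N \<ge> N1 \<Longrightarrow> B\<^sup>2 / mass n * (\<Sum>j. mass (j + N)) < \<epsilon>" by (auto simp: eventually_sequentially)
  \<comment> \<open>Large enough for the bound \<open>B\<close>, for a tail below
    \<open>\<epsilon>\<close>, and for \<open>n\<close> to be among the nodes.\<close>
  define N where "N = max (max N0 N1) (Suc n)"
  have N: "N \<ge> N0" "N \<ge> N1" "n < N" by (auto simp: N_def)
  obtain I c where c: "\<And>x. lagrange p n N x = (\<Sum>k<I. c k * R (2 * k + p) x)"
    using parity_span_expand[OF parity_span_lagrange[OF p]] by metis
  define w where "w i = sqrt (weight (2 * i + p) / moment 0 0)" for i
  have w: "w i \<noteq> 0" for i using weight_pos[of "2 * i + p"] moment_0_0_pos by (simp add: w_def)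
  have V: "V p i j = sqrt (mass j) * w i * R (2 * i + p) (q ^ j)" for i j
    unfolding V_def w_def by (simp add: real_sqrt_mult real_sqrt_divide)
  define e where "e i = c i / (w i * sqrt (mass n))" for i
  have sum: "(\<Sum>i<I. e i * V p i j) = sqrt (mass j) / sqrt (mass n) * lagrange p n N (q ^ j)" for j
    unfolding c sum_distrib_left V e_def using w by (intro sum.cong) auto
  define r where "r j = ((if j = n then 1 else 0) - (\<Sum>i<I. e i * V p i j))\<^sup>2" for j
  have r0: "r j = 0" if "j < N" for j
    using that lagrange_self lagrange_zero[of j N n p] mass_pos[of n] unfolding r_def sum by (cases "j = n") auto
  have r1: "r j \<le> B\<^sup>2 / mass n * mass j" if "N \<le> j" for j
  proof -
    have "r j = mass j / mass n * (lagrange p n N (q ^ j))\<^sup>2"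
      using that N mass_pos[of j] mass_pos[of n] unfolding r_def sum by (simp add: power_mult_distrib power_divide)
    also have "(lagrange p n N (q ^ j))\<^sup>2 \<le> B\<^sup>2"
      using B[OF N(1) that] by (simp add: abs_le_square_iff[symmetric])
    finally show ?thesis using mass_pos[of j] mass_pos[of n] by (simp add: mult.commute divide_right_mono)
  qed
  have sB: "summable (\<lambda>j. B\<^sup>2 / mass n * mass (j + N))"
    by (intro summable_mult summable_ignore_initial_segment summable_mass)
  have "summable (\<lambda>j. r (j + N))"
    by (rule summable_comparison_test'[OF sB, of 0]) (use r1 in \<open>auto simp: r_def\<close>)
  then have sr: "summable r" by (simp add: summable_iff_shift)
  have "suminf r = (\<Sum>j. r (j + N)) + sum r {..<N}"
    by (rule suminf_split_initial_segment[OF sr])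
  also have "sum r {..<N} = 0" using r0 by simp
  also have "(\<Sum>j. r (j + N)) \<le> (\<Sum>j. B\<^sup>2 / mass n * mass (j + N))"
    by (intro suminf_le sB r1) (use sr in \<open>auto simp: summable_iff_shift\<close>)
  also have "\<dots> = B\<^sup>2 / mass n * (\<Sum>j. mass (j + N))"
    by (intro suminf_mult summable_ignore_initial_segment summable_mass)
  also have "\<dots> < \<epsilon>" by (rule N1[OF N(2)])
  finally have "suminf r < \<epsilon>" by simp
  moreover have "r sums suminf r" by (rule summable_sums[OF sr])
  ultimately show ?thesis unfolding r_def by blast
qed

lemma V_transpose_orthonormal:
  assumes "p < 2"
  shows "(\<lambda>k. V p k n * V p k n') sums (if n = n' then 1 else 0)"
  by (rule orthonormal_transpose[OF V_orthonormal
        orthonormal_complete_imp_coordinate_sums[OF V_orthonormal V_complete[OF assms]]])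

lemma dualD_extremal:
  assumes p: "p < 2" and w: "\<And>k. w k = weight (2 * k + p)"
  shows "(\<lambda>k. w k * poly (dualD a q n) (mu a q (real (2 * k + p))) * poly (dualD a q n') (mu a q (real (2 * k + p))))
      sums (moment 0 0 / mass n * (if n = n' then 1 else 0))"
    and "extremal (discrete_measure w (\<lambda>k. mu a q (real (2 * k + p)))) (dualD a q)"
proof -
  have V: "V p k n = sqrt (w k / (moment 0 0 / mass n)) * poly (dualD a q n) (mu a q (real (2 * k + p)))" for n k
    unfolding poly_dualD_mu V_def w by (simp add: mult.commute)
  have pos: "0 < w k" "0 < moment 0 0 / mass n" for k n using weight_pos moment_0_0_pos mass_pos w by auto
  \<comment> \<open>The transpose is used here: its rows, indexed by the degree \<open>n\<close>,
    are orthonormal by \<open>V_transpose_orthonormal\<close>, and dense because its columns are the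
    orthonormal rows of \<open>V\<close>.\<close>
  note * = extremal_discrete_measure[where V = "\<lambda>n k. V p k n", OF pos V V_transpose_orthonormal[OF p]
     orthonormal_transpose_dense[OF V_transpose_orthonormal[OF p] V_orthonormal]]
  show "(\<lambda>k. w k * poly (dualD a q n) (mu a q (real (2 * k + p))) * poly (dualD a q n') (mu a q (real (2 * k + p))))
      sums (moment 0 0 / mass n * (if n = n' then 1 else 0))"
    by (rule *(1))
  show "extremal (discrete_measure w (\<lambda>k. mu a q (real (2 * k + p)))) (dualD a q)"
    by (rule *(2))
qed

section \<open>Weights and norms of the theorem\<close>

lemma weight_even_eq: "weight_even a q k = weight (2 * k + 0)"
proof -
  have "2 * k * (2 * k - 1) div 2 = k * (2 * k - 1)" by (simp add: mult.assoc)
  then show ?thesis unfolding weight_even_def weight_def by (simp add: mult_2[symmetric] add.commute)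
qed

lemma weight_odd_eq: "weight_odd a q k = weight (2 * k + 1)"
proof -
  have "(2 * k + 1) * (2 * k + 1 - 1) div 2 = k * (2 * k + 1)" by (simp add: mult_ac)
  moreover have "2 * (2 * k + 1) + 1 = 4 * k + (3::nat)" by simp
  ultimately show ?thesis unfolding weight_odd_def weight_def by (simp only:)
qed

lemma norm_eq: "moment 0 0 / mass n = qpoch_inf (- a * q ^ 3) (q\<^sup>2) / qpoch_inf q (q\<^sup>2)
   * (qpoch (q\<^sup>2) (q\<^sup>2) n * q powi (- int n) / qpoch (- a * q\<^sup>2) (q\<^sup>2) n)"
  unfolding moment_0_0 mass_def by (simp add: power_int_minus field_simps)

end

theorem mainTheorem3:
  fixes a q :: real
  assumes "0 < q" and "q < 1" and "0 < a"
  shows "(\<forall>n n'. (\<lambda>k. weight_even a q k * poly (dualD a q n) (mu a q (real (2 * k)))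
                                        * poly (dualD a q n') (mu a q (real (2 * k))))
           sums (qpoch_inf (- a * q ^ 3) (q\<^sup>2) / qpoch_inf q (q\<^sup>2)
                 * (qpoch (q\<^sup>2) (q\<^sup>2) n * q powi (- int n) / qpoch (- a * q\<^sup>2) (q\<^sup>2) n)
                 * (if n = n' then 1 else 0)))
       \<and> (\<forall>n n'. (\<lambda>k. weight_odd a q k * poly (dualD a q n) (mu a q (real (2 * k + 1)))
                                       * poly (dualD a q n') (mu a q (real (2 * k + 1))))
           sums (qpoch_inf (- a * q ^ 3) (q\<^sup>2) / qpoch_inf q (q\<^sup>2)
                 * (qpoch (q\<^sup>2) (q\<^sup>2) n * q powi (- int n) / qpoch (- a * q\<^sup>2) (q\<^sup>2) n)
                 * (if n = n' then 1 else 0)))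
       \<and> extremal (discrete_measure (weight_even a q) (\<lambda>k. mu a q (real (2 * k)))) (dualD a q)
       \<and> extremal (discrete_measure (weight_odd a q) (\<lambda>k. mu a q (real (2 * k + 1)))) (dualD a q)"
proof -
  interpret dual_q_ultraspherical a q by unfold_locales (fact assms)+
  note even = dualD_extremal[of 0 "weight_even a q", OF _ weight_even_eq, unfolded norm_eq add_0_right]
  note odd = dualD_extremal[of 1 "weight_odd a q", OF _ weight_odd_eq, unfolded norm_eq]
  show ?thesis
    by (intro conjI allI even odd) simp_all
qed

end
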